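(* For all $w_1\in\mathfrak{H}^1$ and $w_2\in\mathfrak{H}^0$, \[ \overline{Z}^{\overline{*}}\bigl(w_1\,\overline{\sqcup\!\!\sqcup}\,w_2-w_1\,\overline{*}\,w_2\bigr)=0 \quad\text{and}\quad \overline{Z}^{\overline{\sqcup\!\!\sqcup}}\bigl(w_1\,\overline{\sqcup\!\!\sqcup}\,w_2-w_1\,\overline{*}\,w_2\bigr)=0 . \]
   Context: Let $\mathfrak{H}=\mathbb{Q}\langle x,y\rangle$ be the noncommutative polynomial ring in $x,y$, $\mathfrak{H}^1=\mathbb{Q}+\mathfrak{H}y$, $\mathfrak{H}^0=\mathbb{Q}+x\mathfrak{H}y$, and $z_k=x^{k-1}y$ ($k\ge1$); $\mathfrak{H}^1$ is freely generated (under concatenation) by the $z_k$, and words of $\mathfrak{H}^0$ other than $1$ are $z_{k_1}\cdots z_{k_n}$ with $k_1\ge2$. The n-evaluation map $\overline{Z}:\mathfrak{H}^0\to\mathbb{R}$ is the $\mathbb{Q}$-linear map with $\overline{Z}(1)=1$ and $\overline{Z}(z_{k_1}\cdots z_{k_n})=\overline{\zeta}(k_1,\ldots,k_n)=\sum_{m_1\ge\cdots\ge m_n>0}m_1^{-k_1}\cdots m_n^{-k_n}$. The n-harmonic product $\overline{*}$ on $\mathfrak{H}^1$ is the $\mathbb{Q}$-bilinear product defined inductively by $1\,\overline{*}\,w=w\,\overline{*}\,1=w$ and $z_kw_1\,\overline{*}\,z_lw_2=z_k(w_1\,\overline{*}\,z_lw_2)+z_l(z_kw_1\,\overline{*}\,w_2)-z_{k+l}(w_1\,\overline{*}\,w_2)$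 for words $w,w_1,w_2\in\mathfrak{H}^1$, $k,l\ge1$. The n-shuffle product $\overline{\sqcup\!\!\sqcup}$ on $\mathfrak{H}$ is the $\mathbb{Q}$-bilinear product defined inductively by $1\,\overline{\sqcup\!\!\sqcup}\,w=w\,\overline{\sqcup\!\!\sqcup}\,1=w$ and $u_1w_1\,\overline{\sqcup\!\!\sqcup}\,u_2w_2=u_1(w_1\,\overline{\sqcup\!\!\sqcup}\,u_2w_2)+u_2(u_1w_1\,\overline{\sqcup\!\!\sqcup}\,w_2)-\delta(w_1)\tau(u_1)u_2w_2-\delta(w_2)\tau(u_2)u_1w_1$ for $u_1,u_2\in\{x,y\}$ and words $w,w_1,w_2\in\mathfrak{H}$, where $\delta(w)=1$ if $w=1$ and $0$ otherwise, and $\tau(x)=y$, $\tau(y)=x$. Both products are commutative and associative, making $\mathfrak{H}^1$ into commutative $\mathbb{Q}$-algebras $\mathfrak{H}^1_{\overline{*}}$ and $\mathfrak{H}^1_{\overline{\sqcup\!\!\sqcup}}$ with $\mathfrak{H}^0$ a subalgebra. $\overline{Z}^{\overline{*}}:\mathfrak{H}^1_{\overline{*}}\to\mathbb{R}[T]$ and $\overline{Z}^{\overline{\sqcup\!\!\sqcup}}:\mathfrak{H}^1_{\overline{\sqcup\!\!\sqcup}}\to\mathbb{R}[T]$ denote the unique algebra homomorphisms extending $\overline{Z}$ on $\mathfrak{H}^0$ and sending $y$ to $T$. *)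

theory Defs
  imports
    "HOL-Analysis.Analysis"
    "HOL-Library.Poly_Mapping"
    "HOL-Library.FuncSet"
    "HOL-Computational_Algebra.Polynomial"
begin

text \<open>Words form the free monoid under concatenation, written additively so that
  the monoid ring construction \<^typ>\<open>'a \<Rightarrow>\<^sub>0 'b\<close> applies.\<close>

instantiation list :: (type) monoid_add
begin

definition zero_list :: "'a list" where "zero_list = []"

definition plus_list :: "'a list \<Rightarrow> 'a list \<Rightarrow> 'a list" where "plus_list = (@)"

instance
  by standard (simp_all add: zero_list_def plus_list_def)

end

datatype letter = X | Y

text \<open>The monoid ring of the free monoid on \<open>X\<close>, \<open>Y\<close> over the rationals, that is, the
  noncommutative polynomial ring; its multiplication \<open>*\<close> extends concatenation.\<close>

type_synonym ncpoly = "letter list \<Rightarrow>\<^sub>0 rat"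

definition word :: "letter list \<Rightarrow> ncpoly" where
  "word w = Poly_Mapping.single w 1"

definition scalar :: "rat \<Rightarrow> ncpoly" where
  "scalar c = Poly_Mapping.single 0 c"

definition H1 :: "ncpoly set" where
  "H1 = {scalar c + h * word [Y] | c h. True}"

definition H0 :: "ncpoly set" where
  "H0 = {scalar c + word [X] * h * word [Y] | c h. True}"

definition zgen :: "nat \<Rightarrow> letter list" where
  "zgen k = replicate (k - 1) X @ [Y]"

definition zword :: "nat list \<Rightarrow> letter list" where
  "zword ks = concat (map zgen ks)"

text \<open>The unique index \<open>[k\<^sub>1, \<dots>, k\<^sub>n]\<close> of a word \<open>zgen k\<^sub>1 \<cdots> zgen k\<^sub>n\<close>; only meaningful
  for words that are empty or end in \<open>Y\<close>.\<close>

definition index_of :: "letter list \<Rightarrow> nat list" where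
  "index_of w = (THE ks. (\<forall>k\<in>set ks. k \<ge> 1) \<and> w = zword ks)"

lemma replicate_X_Y_inject:
  "replicate m X @ Y # u = replicate n X @ Y # v \<longleftrightarrow> m = n \<and> u = v"
proof (induction m arbitrary: n)
  case 0
  then show ?case by (cases n) auto
next
  case (Suc m)
  then show ?case by (cases n) auto
qed

lemma zword_inject:
  assumes "\<forall>k\<in>set ks. k \<ge> 1" "\<forall>l\<in>set ls. l \<ge> 1" "zword ks = zword ls"
  shows "ks = ls"
  using assms
proof (induction ks arbitrary: ls)
  case Nil
  then show ?case by (cases ls) (auto simp: zword_def zgen_def)
next
  case (Cons k ks)
  then obtain l ls' where ls: "ls = l # ls'"
    by (cases ls) (auto simp: zword_def zgen_def)
  from Cons.prems have "k - 1 = l - 1 \<and> zword ks = zword ls'"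
    by (simp add: ls zword_def zgen_def replicate_X_Y_inject)
  with Cons.prems Cons.IH[of ls'] show ?case
    by (auto simp: ls)
qed

lemma index_of_zword: "\<forall>k\<in>set ks. k \<ge> 1 \<Longrightarrow> index_of (zword ks) = ks"
  unfolding index_of_def by (rule the_equality) (auto intro: zword_inject)

text \<open>Non-strict multiple zeta values. The terms are nonnegative, so the unordered sum
  is the usual one whenever the series converges (as it does if \<open>k\<^sub>1 \<ge> 2\<close>).\<close>

definition zeta_bar :: "nat list \<Rightarrow> real" where
  "zeta_bar ks =
     (\<Sum>\<^sub>\<infinity>ms\<in>{ms. length ms = length ks \<and> sorted_wrt (\<ge>) ms \<and> (\<forall>m\<in>set ms. m > 0)}.
        \<Prod>i<length ks. 1 / real (ms ! i) ^ (ks ! i))"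

definition Zbar :: "ncpoly \<Rightarrow> real" where
  "Zbar p = (\<Sum>w\<in>Poly_Mapping.keys p.
     of_rat (Poly_Mapping.lookup p w) * zeta_bar (index_of w))"

definition bilinear_ext ::
  "(letter list \<Rightarrow> letter list \<Rightarrow> ncpoly) \<Rightarrow> ncpoly \<Rightarrow> ncpoly \<Rightarrow> ncpoly" where
  "bilinear_ext f p q = (\<Sum>u\<in>Poly_Mapping.keys p. \<Sum>v\<in>Poly_Mapping.keys q.
     scalar (Poly_Mapping.lookup p u * Poly_Mapping.lookup q v) * f u v)"

lemma bilinear_ext_word: "bilinear_ext f (word u) (word v) = f u v"
  by (simp add: bilinear_ext_def word_def scalar_def)

text \<open>The harmonic product of two words \<open>zword ks\<close> and \<open>zword ls\<close>, by recursion on the indices.\<close>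

fun nharm_index :: "nat list \<Rightarrow> nat list \<Rightarrow> ncpoly" where
  "nharm_index [] ls = word (zword ls)"
| "nharm_index ks [] = word (zword ks)"
| "nharm_index (k # ks) (l # ls) =
     word (zgen k) * nharm_index ks (l # ls) + word (zgen l) * nharm_index (k # ks) ls
     - word (zgen (k + l)) * nharm_index ks ls"

definition nharm :: "ncpoly \<Rightarrow> ncpoly \<Rightarrow> ncpoly" where
  "nharm = bilinear_ext (\<lambda>u v. nharm_index (index_of u) (index_of v))"

lemma nharm_zword:
  assumes "\<forall>k\<in>set ks. k \<ge> 1" "\<forall>l\<in>set ls. l \<ge> 1"
  shows "nharm (word (zword ks)) (word (zword ls)) = nharm_index ks ls"
  using assms by (simp add: nharm_def bilinear_ext_word index_of_zword)

definition delta :: "letter list \<Rightarrow> rat" where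
  "delta w = (if w = [] then 1 else 0)"

fun tau :: "letter \<Rightarrow> letter" where
  "tau X = Y"
| "tau Y = X"

fun nshuffle_word :: "letter list \<Rightarrow> letter list \<Rightarrow> ncpoly" where
  "nshuffle_word [] w = word w"
| "nshuffle_word w [] = word w"
| "nshuffle_word (a # u) (b # v) =
     word [a] * nshuffle_word u (b # v) + word [b] * nshuffle_word (a # u) v
     - scalar (delta u) * word (tau a # b # v) - scalar (delta v) * word (tau b # a # u)"

definition nshuffle :: "ncpoly \<Rightarrow> ncpoly \<Rightarrow> ncpoly" where
  "nshuffle = bilinear_ext nshuffle_word"

text \<open>\<open>f\<close> restricts to a homomorphism of rational algebras from \<open>H1\<close>, with \<open>prd\<close> as
  multiplication, to the polynomial ring \<^typ>\<open>real poly\<close>.\<close>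

definition H1_alg_hom :: "(ncpoly \<Rightarrow> ncpoly \<Rightarrow> ncpoly) \<Rightarrow> (ncpoly \<Rightarrow> real poly) \<Rightarrow> bool" where
  "H1_alg_hom prd f \<longleftrightarrow>
     (\<forall>p\<in>H1. \<forall>q\<in>H1. f (p + q) = f p + f q) \<and>
     (\<forall>c. \<forall>p\<in>H1. f (scalar c * p) = smult (of_rat c) (f p)) \<and>
     f 1 = 1 \<and>
     (\<forall>p\<in>H1. \<forall>q\<in>H1. f (prd p q) = f p * f q)"

text \<open>The unique algebra homomorphism on \<open>H1\<close> extending \<^const>\<open>Zbar\<close> and sending \<open>y\<close> to the
  polynomial variable. Extensionality fixes the irrelevant values outside \<open>H1\<close>, so that
  uniqueness on \<open>H1\<close> becomes uniqueness of the HOL function.\<close>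

definition Zbar_ext :: "(ncpoly \<Rightarrow> ncpoly \<Rightarrow> ncpoly) \<Rightarrow> ncpoly \<Rightarrow> real poly" where
  "Zbar_ext prd = (THE f. f \<in> extensional H1 \<and> H1_alg_hom prd f \<and>
     (\<forall>p\<in>H0. f p = [:Zbar p:]) \<and> f (word [Y]) = [:0, 1:])"

definition Zbar_harm :: "ncpoly \<Rightarrow> real poly" where
  "Zbar_harm = Zbar_ext nharm"

definition Zbar_shuffle :: "ncpoly \<Rightarrow> real poly" where
  "Zbar_shuffle = Zbar_ext nshuffle"

end

theory Submission
  imports Defs "HOL-Real_Asymp.Real_Asymp"
begin

text \<open>The truncated sums of the n-zeta values multiply like the harmonic product, and the
  polylogarithms \<open>t \<mapsto> \<Sum>\<^sub>m (m-th term) t\<^sup>m\<close> multiply like the shuffle product. The former are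
  polynomials in the harmonic number \<open>H\<^sub>N\<close> as \<open>N \<rightarrow> \<infinity>\<close>, the latter are polynomials in
  \<open>- ln (1 - t)\<close> as \<open>t \<rightarrow> 1\<close>, up to errors smaller than every negative power of these quantities;
  the polynomials are the two regularizations. Both assertions then follow from the comparison,
  in the manner of Abel, of the limit of a sequence of partial sums with the limit of the power series.

  Let \<open>p\<close> be the shuffle product minus the harmonic product of \<open>w\<^sub>1\<close> and \<open>w\<^sub>2\<close>, and let
  \<open>c = Zbar w\<^sub>2\<close>. The truncated sums of the harmonic product minus \<open>c w\<^sub>1\<close> tend to 0, hence so
  does the polylogarithm. As the polylogarithm of the shuffle product minus \<open>c w\<^sub>1\<close> tends to 0 as
  well, the shuffle regularization of \<open>p\<close> vanishes. If the harmonic regularization of \<open>p\<close> were a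
  nonzero polynomial, the truncated sums of \<open>p\<close> would eventually be bounded away from 0 with
  constant sign, and so would be its polylogarithm near 1.\<close>

section \<open>Linear extension and support\<close>

definition supported :: "letter list set \<Rightarrow> ncpoly set" where
  "supported A = {p. Poly_Mapping.keys p \<subseteq> A}"

definition lin_ext :: "(letter list \<Rightarrow> real) \<Rightarrow> ncpoly \<Rightarrow> real" where
  "lin_ext g p = (\<Sum>w\<in>Poly_Mapping.keys p. of_rat (Poly_Mapping.lookup p w) * g w)"

definition H1_words :: "letter list set" where
  "H1_words = {w. w = [] \<or> last w = Y}"

definition H0_words :: "letter list set" where
  "H0_words = {w. w = [] \<or> hd w = X \<and> last w = Y}"

lemma word_Nil: "word [] = 1"
  by (metis word_def zero_list_def single_one)

lemma word_append: "word (u @ v) = word u * word v"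
  by (simp add: word_def mult_single plus_list_def)

lemma scalar_mult_word: "scalar c * word w = Poly_Mapping.single w c"
  by (simp add: scalar_def word_def mult_single)

lemma sum_words: "p = (\<Sum>w\<in>Poly_Mapping.keys p. scalar (Poly_Mapping.lookup p w) * word w)"
  unfolding scalar_mult_word
  by (rule poly_mapping_eqI)
    (auto simp: lookup_sum lookup_single when_def in_keys_iff
      cong: if_cong)

lemma supported_0 [simp, intro]: "0 \<in> supported A"
  by (simp add: supported_def)

lemma supported_add [intro]: "p \<in> supported A \<Longrightarrow> q \<in> supported A \<Longrightarrow> p + q \<in> supported A"
  using keys_add[of p q] by (auto simp: supported_def)

lemma supported_uminus: "p \<in> supported A \<Longrightarrow> - p \<in> supported A"
  by (simp add: supported_def in_keys_iff subset_eq)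

lemma supported_diff [intro]: "p \<in> supported A \<Longrightarrow> q \<in> supported A \<Longrightarrow> p - q \<in> supported A"
  using supported_add[of p A "- q"] supported_uminus[of q A] by simp

lemma supported_sum [intro]: "(\<And>i. i \<in> I \<Longrightarrow> f i \<in> supported A) \<Longrightarrow> sum f I \<in> supported A"
  by (induction I rule: infinite_finite_induct) auto

lemma supported_word [intro]: "w \<in> A \<Longrightarrow> word w \<in> supported A"
  by (simp add: supported_def word_def)

lemma supported_single_mult:
  assumes "p \<in> supported A" "\<And>w. w \<in> A \<Longrightarrow> u @ w \<in> B"
  shows "Poly_Mapping.single u c * p \<in> supported B"
  using assms keys_mult[of "Poly_Mapping.single u c" p]
  by (fastforce simp: supported_def plus_list_def split: if_splits)

lemma supported_word_mult:
  assumes "p \<in> supported A" "\<And>w. w \<in> A \<Longrightarrow> u @ w \<in> B"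
  shows "word u * p \<in> supported B"
  unfolding word_def by (rule supported_single_mult[OF assms])

lemma supported_scalar_mult [intro]: "p \<in> supported A \<Longrightarrow> scalar c * p \<in> supported A"
  unfolding scalar_def by (erule supported_single_mult) (simp add: zero_list_def)

lemma supported_mono: "p \<in> supported A \<Longrightarrow> A \<subseteq> B \<Longrightarrow> p \<in> supported B"
  by (auto simp: supported_def)

text \<open>The finite expansion \<open>sum_words\<close> reduces every additive property to scalar
  multiples of single words.\<close>

lemma supported_induct [consumes 1, case_names zero add word]:
  assumes "p \<in> supported A"
    and "P 0"
    and "\<And>p q. p \<in> supported A \<Longrightarrow> q \<in> supported A \<Longrightarrow> P p \<Longrightarrow> P q \<Longrightarrow> P (p + q)"
    and "\<And>c w. w \<in> A \<Longrightarrow> P (scalar c * word w)"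
  shows "P p"
proof -
  have "P (\<Sum>w\<in>B. scalar (Poly_Mapping.lookup p w) * word w)"
    if "finite B" "B \<subseteq> Poly_Mapping.keys p" for B
    using that
  proof (induction B)
    case (insert w B)
    moreover have "Poly_Mapping.keys p \<subseteq> A"
      using assms(1) by (simp add: supported_def)
    ultimately show ?case
      by (auto intro!: assms(3,4) supported_sum supported_scalar_mult supported_word)
  qed (simp add: assms(2))
  then show ?thesis
    by (subst sum_words) auto
qed

lemma in_supported_UNIV: "p \<in> supported UNIV"
  by (simp add: supported_def)

lemma scalar_commute: "scalar c * p = p * scalar c"
proof (induction rule: supported_induct[OF in_supported_UNIV[of p]])
  case (3 d w)
  then show ?case
    by (simp add: scalar_mult_word) (simp add: scalar_def mult_single mult.commute)
qed (simp_all add: algebra_simps)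

text \<open>Right multiplication by \<open>word [Y]\<close> produces exactly the words ending in
  \<open>Y\<close>. Membership thus becomes a condition on keys, and \<open>supported_induct\<close>
  applies to \<open>H1\<close>.\<close>

lemma H1_eq: "H1 = supported H1_words"
proof (intro equalityI subsetI)
  fix p assume "p \<in> H1"
  then obtain c h where p: "p = scalar c + h * word [Y]"
    by (auto simp: H1_def)
  have "h * word [Y] \<in> supported H1_words"
    using keys_mult[of h "word [Y]"]
    by (auto simp: supported_def H1_words_def word_def plus_list_def)
  moreover have "scalar c \<in> supported H1_words"
    by (simp add: supported_def H1_words_def scalar_def zero_list_def)
  ultimately show "p \<in> supported H1_words" unfolding p by blast
next
  fix p assume "p \<in> supported H1_words"
  then show "p \<in> H1"
  proof (induction rule: supported_induct)
    case zero
    have "0 = scalar 0 + 0 * word [Y]" by (simp add: scalar_def)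
    then show ?case unfolding H1_def by blast
  next
    case (add p q)
    then obtain c h c' h' where "p = scalar c + h * word [Y]" "q = scalar c' + h' * word [Y]"
      by (auto simp: H1_def)
    then have "p + q = scalar (c + c') + (h + h') * word [Y]"
      by (simp add: scalar_def single_add algebra_simps)
    then show ?case unfolding H1_def by blast
  next
    case (word c w)
    show ?case
    proof (cases w rule: rev_cases)
      case Nil
      then have "scalar c * word w = scalar c + 0 * word [Y]" by (simp add: word_Nil)
      then show ?thesis unfolding H1_def by blast
    next
      case (snoc v b)
      then have "scalar c * word w = scalar 0 + (scalar c * word v) * word [Y]"
        using word by (simp add: H1_words_def word_append scalar_def mult.assoc)
      then show ?thesis unfolding H1_def by blast
    qed
  qed
qed

lemma H0_eq: "H0 = supported H0_words"
proof (intro equalityI subsetI)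
  fix p assume "p \<in> H0"
  then obtain c h where p: "p = scalar c + word [X] * h * word [Y]"
    by (auto simp: H0_def)
  have "word [X] * h * word [Y] \<in> supported H0_words"
    using keys_mult[of "word [X] * h" "word [Y]"] keys_mult[of "word [X]" h]
    by (fastforce simp: supported_def H0_words_def word_def plus_list_def)
  moreover have "scalar c \<in> supported H0_words"
    by (simp add: supported_def H0_words_def scalar_def zero_list_def)
  ultimately show "p \<in> supported H0_words" unfolding p by blast
next
  fix p assume "p \<in> supported H0_words"
  then show "p \<in> H0"
  proof (induction rule: supported_induct)
    case zero
    have "0 = scalar 0 + word [X] * 0 * word [Y]" by (simp add: scalar_def)
    then show ?case unfolding H0_def by blast
  next
    case (add p q)
    then obtain c h c' h' where
      "p = scalar c + word [X] * h * word [Y]" "q = scalar c' + word [X] * h' * word [Y]"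
      by (auto simp: H0_def)
    then have "p + q = scalar (c + c') + word [X] * (h + h') * word [Y]"
      by (simp add: scalar_def single_add algebra_simps)
    then show ?case unfolding H0_def by blast
  next
    case (word c w)
    show ?case
    proof (cases "w = []")
      case True
      then have "scalar c * word w = scalar c + word [X] * 0 * word [Y]" by (simp add: word_Nil)
      then show ?thesis unfolding H0_def by blast
    next
      case False
      with word have "hd w = X" "last w = Y" by (auto simp: H0_words_def)
      with False obtain v where "w = [X] @ v @ [Y]"
        by (metis append_Cons append_Nil append_butlast_last_id last_ConsL last_ConsR letter.distinct(1) list.collapse)
      then have "word w = word [X] * word v * word [Y]"
        by (simp only: word_append mult.assoc)
      then have "scalar c * word w = scalar 0 + word [X] * (scalar c * word v) * word [Y]"
        by (simp add: scalar_commute[of c] mult.assoc) (simp add: scalar_def)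
      then show ?thesis unfolding H0_def by blast
    qed
  qed
qed

section \<open>Linear functionals on noncommutative polynomials\<close>

lemma lin_ext_superset:
  assumes "finite B" "Poly_Mapping.keys p \<subseteq> B"
  shows "lin_ext g p = (\<Sum>w\<in>B. of_rat (Poly_Mapping.lookup p w) * g w)"
  unfolding lin_ext_def using assms
  by (intro sum.mono_neutral_left) (auto simp: in_keys_iff)

lemma lin_ext_0 [simp]: "lin_ext g 0 = 0"
  by (simp add: lin_ext_def)

lemma lin_ext_add: "lin_ext g (p + q) = lin_ext g p + lin_ext g q"
proof -
  let ?B = "Poly_Mapping.keys p \<union> Poly_Mapping.keys q"
  have "lin_ext g r = (\<Sum>w\<in>?B. of_rat (Poly_Mapping.lookup r w) * g w)"
    if "r \<in> {p, q, p + q}" for r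
    using that keys_add[of p q] by (intro lin_ext_superset) auto
  then show ?thesis
    by (simp add: lookup_add of_rat_add algebra_simps sum.distrib)
qed

lemma lin_ext_uminus: "lin_ext g (- p) = - lin_ext g p"
  using lin_ext_add[of g p "- p"] by simp

lemma lin_ext_diff: "lin_ext g (p - q) = lin_ext g p - lin_ext g q"
  using lin_ext_add[of g p "- q"] by (simp add: lin_ext_uminus)

lemma lin_ext_sum: "lin_ext g (sum f I) = (\<Sum>i\<in>I. lin_ext g (f i))"
  by (induction I rule: infinite_finite_induct) (simp_all add: lin_ext_add)

lemma lin_ext_single: "lin_ext g (Poly_Mapping.single w c) = of_rat c * g w"
  by (cases "c = 0") (simp_all add: lin_ext_def)

lemma lin_ext_word [simp]: "lin_ext g (word w) = g w"
  by (simp add: word_def lin_ext_single)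

text \<open>The prefix \<open>u\<close> moves from the polynomial to the functional. In this way
  recursions on the first letter of a word reach the products, which are defined by
  prefixing.\<close>

lemma lin_ext_single_mult:
  "lin_ext g (Poly_Mapping.single u c * p) = of_rat c * lin_ext (\<lambda>w. g (u @ w)) p"
proof (induction rule: supported_induct[OF in_supported_UNIV[of p]])
  case (3 d w)
  then show ?case
    by (simp add: scalar_mult_word mult_single lin_ext_single plus_list_def of_rat_mult)
qed (simp_all add: lin_ext_add algebra_simps)

lemma lin_ext_scalar_mult: "lin_ext g (scalar c * p) = of_rat c * lin_ext g p"
  by (simp add: scalar_def lin_ext_single_mult zero_list_def)

lemma lin_ext_word_mult: "lin_ext g (word u * p) = lin_ext (\<lambda>w. g (u @ w)) p"
  by (simp add: word_def lin_ext_single_mult)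

lemma lin_ext_cong:
  "p \<in> supported A \<Longrightarrow> (\<And>w. w \<in> A \<Longrightarrow> g w = h w) \<Longrightarrow> lin_ext g p = lin_ext h p"
  unfolding lin_ext_def supported_def by (intro sum.cong) auto

lemma lin_ext_bilinear_ext:
  assumes "p \<in> supported A" "q \<in> supported B"
    and "\<And>u v. u \<in> A \<Longrightarrow> v \<in> B \<Longrightarrow> lin_ext g (f u v) = g u * g v"
  shows "lin_ext g (bilinear_ext f p q) = lin_ext g p * lin_ext g q"
proof -
  have "lin_ext g (bilinear_ext f p q) = (\<Sum>u\<in>Poly_Mapping.keys p. \<Sum>v\<in>Poly_Mapping.keys q.
      of_rat (Poly_Mapping.lookup p u * Poly_Mapping.lookup q v) * (g u * g v))"
    unfolding bilinear_ext_def lin_ext_sum lin_ext_scalar_mult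
    using assms by (intro sum.cong refl) (auto simp: supported_def)
  also have "\<dots> = lin_ext g p * lin_ext g q"
    by (simp add: lin_ext_def sum_product of_rat_mult mult_ac)
  finally show ?thesis .
qed

lemma supported_bilinear_ext:
  assumes "p \<in> supported A" "q \<in> supported B"
    and "\<And>u v. u \<in> A \<Longrightarrow> v \<in> B \<Longrightarrow> f u v \<in> supported C"
  shows "bilinear_ext f p q \<in> supported C"
  unfolding bilinear_ext_def using assms
  by (intro supported_sum supported_scalar_mult assms(3)) (auto simp: supported_def)

lemma Zbar_eq: "Zbar p = lin_ext (\<lambda>w. zeta_bar (index_of w)) p"
  by (simp add: Zbar_def lin_ext_def)

section \<open>Generation by \<open>H0\<close> and \<open>y\<close>\<close>

lemma scalar_scalar: "scalar a * (scalar b * p) = scalar (a * b) * p"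
  by (simp add: scalar_def mult.assoc[symmetric] mult_single)

lemma Nil_in_H1_words [simp]: "[] \<in> H1_words"
  by (simp add: H1_words_def)

lemma append_in_H1_words: "v \<in> H1_words \<Longrightarrow> v \<noteq> [] \<Longrightarrow> u @ v \<in> H1_words"
  by (simp add: H1_words_def)

lemma Cons_in_H1_words: "c # w \<in> H1_words \<Longrightarrow> w \<in> H1_words"
  by (simp add: H1_words_def split: if_splits)

lemma H0_words_subset: "H0_words \<subseteq> H1_words"
  by (auto simp: H0_words_def H1_words_def)

lemma H0_subset_H1: "H0 \<subseteq> H1"
  using H0_words_subset supported_mono unfolding H0_eq H1_eq by blast

section \<open>Words of \<open>H1\<close> as index sequences\<close>

lemma zword_Nil [simp]: "zword [] = []"
  by (simp add: zword_def)

lemma zword_Cons: "zword (k # ks) = zgen k @ zword ks"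
  by (simp add: zword_def)

lemma zgen_Suc_0 [simp]: "zgen (Suc 0) = [Y]"
  by (simp add: zgen_def)

lemma zgen_Suc: "k \<ge> 1 \<Longrightarrow> zgen (Suc k) = X # zgen k"
  by (cases k) (simp_all add: zgen_def)

lemma zgen_append_in_H1_words: "w \<in> H1_words \<Longrightarrow> zgen k @ w \<in> H1_words"
  by (auto simp: H1_words_def zgen_def)

lemma zword_in_H1_words: "zword ks \<in> H1_words"
  by (induction ks) (simp_all add: zword_Cons zgen_append_in_H1_words)

lemma zword_replicate_1: "zword (replicate m (Suc 0) @ ks) = replicate m Y @ zword ks"
  by (induction m) (simp_all add: zword_Cons)

text \<open>Read from the right, a \<open>Y\<close> opens a new index 1 and an \<open>X\<close>
  raises the current first index, which exists because the word ends in \<open>Y\<close>.\<close>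

lemma H1_words_zword:
  assumes "w \<in> H1_words"
  obtains ks where "\<forall>k\<in>set ks. k \<ge> 1" "w = zword ks"
proof -
  have "\<exists>ks. (\<forall>k\<in>set ks. k \<ge> 1) \<and> w = zword ks"
    using assms
  proof (induction w)
    case Nil
    show ?case by (rule exI[of _ "[]"]) simp
  next
    case (Cons c w)
    then obtain ks where ks: "\<forall>k\<in>set ks. k \<ge> 1" "w = zword ks"
      using Cons_in_H1_words by blast
    show ?case
    proof (cases c)
      case X
      with Cons.prems have "w \<noteq> []" by (auto simp: H1_words_def)
      with ks obtain k ls where "ks = k # ls" by (cases ks) auto
      with ks X show ?thesis
        by (intro exI[of _ "Suc k # ls"]) (simp add: zword_Cons zgen_Suc)
    next
      case Y
      with ks show ?thesis
        by (intro exI[of _ "1 # ks"]) (simp add: zword_Cons)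
    qed
  qed
  with that show ?thesis by blast
qed

lemma H0_words_zword:
  assumes "w \<in> H0_words"
  obtains ks where "\<forall>k\<in>set ks. k \<ge> 1" "ks = [] \<or> hd ks \<ge> 2" "w = zword ks"
proof -
  from assms have "w \<in> H1_words" using H0_words_subset by blast
  then obtain ks where ks: "\<forall>k\<in>set ks. k \<ge> 1" "w = zword ks"
    by (rule H1_words_zword)
  have "ks = [] \<or> hd ks \<ge> 2"
  proof (cases ks)
    case (Cons k ls)
    with assms ks show ?thesis
      by (cases "k = 1") (auto simp: H0_words_def zword_Cons)
  qed simp
  with ks that show ?thesis by blast
qed

section \<open>Closure of \<open>H1\<close> under both products\<close>

lemma nharm_index_supported: "nharm_index ks ls \<in> supported H1_words"
  by (induction ks ls rule: nharm_index.induct)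
    (simp_all add: supported_word zword_in_H1_words supported_diff supported_add
      supported_word_mult[where A = H1_words] zgen_append_in_H1_words)

lemma nharm_in_H1: "p \<in> H1 \<Longrightarrow> q \<in> H1 \<Longrightarrow> nharm p q \<in> H1"
  unfolding H1_eq nharm_def by (erule (1) supported_bilinear_ext) (rule nharm_index_supported)

text \<open>The correction terms are prefixes put before nonempty words, so the last letter
  survives. The empty word is excluded because prefixing it by \<open>X\<close> would leave
  \<open>H1\<close>.\<close>

lemma nshuffle_word_supported:
  "u \<in> H1_words \<Longrightarrow> v \<in> H1_words \<Longrightarrow> u \<noteq> [] \<or> v \<noteq> []
    \<Longrightarrow> nshuffle_word u v \<in> supported (H1_words - {[]})"
proof (induction u v rule: nshuffle_word.induct)
  case (3 a u b v)
  then have "u \<in> H1_words" "v \<in> H1_words"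
    by (blast dest: Cons_in_H1_words)+
  moreover have "word [c] * p \<in> supported (H1_words - {[]})"
    if "p \<in> supported (H1_words - {[]})" for c p
    using that by (rule supported_word_mult) (simp add: append_in_H1_words[of _ "[c]", simplified])
  ultimately show ?case
    using 3
    by (auto intro!: supported_diff supported_add supported_scalar_mult supported_word
        simp: append_in_H1_words[of "_ # _" "[_]", simplified])
qed auto

lemma nshuffle_in_H1:
  assumes "p \<in> H1" "q \<in> H1"
  shows "nshuffle p q \<in> H1"
  unfolding H1_eq nshuffle_def
proof (rule supported_bilinear_ext)
  fix u v assume "u \<in> H1_words" "v \<in> H1_words"
  then show "nshuffle_word u v \<in> supported H1_words"
    using nshuffle_word_supported[of u v] supported_mono[of _ "H1_words - {[]}" H1_words]
    by (cases "u = [] \<and> v = []") (auto intro: supported_word)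
qed (use assms in \<open>simp_all add: H1_eq\<close>)

section \<open>Filtration of \<open>H1\<close> by the number of leading \<open>Y\<close>\<close>

definition lead_words :: "nat \<Rightarrow> letter list set" where
  "lead_words n = {w \<in> H1_words. length (takeWhile ((=) Y) w) \<le> n}"

lemma lead_words_0: "lead_words 0 = H0_words"
proof (rule set_eqI)
  fix w
  show "w \<in> lead_words 0 \<longleftrightarrow> w \<in> H0_words"
    by (cases w; cases "hd w") (simp_all add: lead_words_def H0_words_def H1_words_def)
qed

lemma Y_Cons_in_lead_words: "w \<in> lead_words n \<Longrightarrow> Y # w \<in> lead_words (Suc n)"
  by (auto simp: lead_words_def H1_words_def)

lemma X_Cons_in_lead_words: "w \<in> H1_words - {[]} \<Longrightarrow> X # w \<in> lead_words n"
  by (auto simp: lead_words_def H1_words_def)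

lemma zgen_append_in_lead_words:
  assumes "w \<in> H1_words" "k \<ge> 2"
  shows "zgen k @ w \<in> lead_words n"
proof -
  have "zgen k @ w = X # zgen (k - 1) @ w"
    using zgen_Suc[of "k - 1"] assms by simp
  then show ?thesis
    using assms zgen_append_in_H1_words[of w "k - 1"]
    by (auto intro!: X_Cons_in_lead_words simp: zgen_def)
qed

text \<open>The product by \<open>y\<close> is triangular with respect to the number of leading \<open>y\<close>, so that
  \<^const>\<open>H1\<close> is generated by \<^const>\<open>H0\<close> and \<open>y\<close>.\<close>

definition triangular :: "(ncpoly \<Rightarrow> ncpoly \<Rightarrow> ncpoly) \<Rightarrow> bool" where
  "triangular prd \<longleftrightarrow> (\<forall>m. \<forall>v\<in>H0_words.
     prd (word [Y]) (word (replicate m Y @ v)) - scalar (of_nat (Suc m)) * word (replicate (Suc m) Y @ v)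
       \<in> supported (lead_words m))"

text \<open>By the triangular relation, a word with \<open>Suc n\<close> leading \<open>Y\<close> is
  \<open>1 / Suc n\<close> times the product of \<open>Y\<close> with a word having \<open>n\<close>
  of them, up to lower terms. Induction on the filtration level follows.\<close>

lemma H1_generated [consumes 2, case_names H0 add scalar mult_Y]:
  assumes "triangular prd" "p \<in> H1"
    and H0: "\<And>p. p \<in> H0 \<Longrightarrow> Q p"
    and add: "\<And>p q. p \<in> H1 \<Longrightarrow> q \<in> H1 \<Longrightarrow> Q p \<Longrightarrow> Q q \<Longrightarrow> Q (p + q)"
    and scalar: "\<And>c p. p \<in> H1 \<Longrightarrow> Q p \<Longrightarrow> Q (scalar c * p)"
    and mult: "\<And>p. p \<in> H1 \<Longrightarrow> prd (word [Y]) p \<in> H1 \<and> (Q p \<longrightarrow> Q (prd (word [Y]) p))"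
  shows "Q p"
proof -
  have H1: "q \<in> H1" if "q \<in> supported (lead_words n)" for q n
    using that unfolding H1_eq by (rule supported_mono) (auto simp: lead_words_def)
  have *: "Q p" if "p \<in> supported (lead_words n)" for n p
    using that
  proof (induction n arbitrary: p)
    case 0
    then show ?case by (simp add: lead_words_0 H0 H0_eq)
  next
    case (Suc n)
    from Suc.prems show ?case
    proof (induction rule: supported_induct)
      case zero
      show ?case by (rule H0) (simp add: H0_eq)
    next
      case (add p q)
      then show ?case using H1 assms(4) by blast
    next
      case (word c w)
      show ?case
      proof (cases "w \<in> lead_words n")
        case True
        then show ?thesis by (intro Suc.IH supported_scalar_mult supported_word)
      next
        case False
        \<comment> \<open>Not being at level \<open>n\<close>, the word has exactly
          \<open>Suc n\<close> leading \<open>Y\<close>; the rest \<open>v\<close> is empty or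
          starts with \<open>X\<close>.\<close>
        define v where "v = dropWhile ((=) Y) w"
        have len: "length (takeWhile ((=) Y) w) = Suc n" and w: "w \<in> H1_words"
          using word False by (auto simp: lead_words_def)
        have "takeWhile ((=) Y) w = replicate (Suc n) Y"
          unfolding len[symmetric] by (rule replicate_eqI) (auto dest: set_takeWhileD)
        then have w_eq: "w = replicate (Suc n) Y @ v"
          using takeWhile_dropWhile_id[of "(=) Y" w] by (simp add: v_def)
        have v: "v \<in> H0_words"
        proof (cases "v = []")
          case False
          then have "hd v \<noteq> Y" using hd_dropWhile[of "(=) Y" w] by (auto simp: v_def)
          moreover have "last v = Y" using w w_eq False by (simp add: H1_words_def)
          ultimately show ?thesis by (cases "hd v") (auto simp: H0_words_def)
        qed (simp add: H0_words_def)
        define u where "u = word (replicate n Y @ v)"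
        define r where "r = prd (word [Y]) u - scalar (of_nat (Suc n)) * word w"
        have r: "r \<in> supported (lead_words n)"
          using assms(1) v unfolding triangular_def r_def u_def w_eq by blast
        have "replicate n Y @ v \<in> lead_words n"
        proof -
          have "v \<in> lead_words 0" using v by (simp add: lead_words_0)
          then show ?thesis by (induction n) (simp_all add: Y_Cons_in_lead_words)
        qed
        then have u: "u \<in> supported (lead_words n)" unfolding u_def by blast
        have "scalar c * word w
            = scalar (c / of_nat (Suc n)) * prd (word [Y]) u + scalar (- c / of_nat (Suc n)) * r"
        proof -
          have "prd (word [Y]) u = scalar (of_nat (Suc n)) * word w + r" by (simp add: r_def)
          moreover have "scalar (c / of_nat (Suc n)) * (scalar (of_nat (Suc n)) * word w)
              = scalar c * word w"
            by (simp add: scalar_scalar del: of_nat_Suc)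
          moreover have "scalar (- c / of_nat (Suc n)) = - scalar (c / of_nat (Suc n))"
            by (simp add: scalar_def single_uminus[symmetric])
          ultimately show ?thesis by (simp add: distrib_left)
        qed
        moreover have "Q r" "Q u" using r u Suc.IH by auto
        moreover have "r \<in> H1" "u \<in> H1" using r u H1 by auto
        ultimately show ?thesis
          using mult[of u] by (auto intro!: assms(4) scalar simp: H1_eq)
      qed
    qed
  qed
  show ?thesis
  proof (rule *)
    \<comment> \<open>The level is the largest number of leading \<open>Y\<close> among the words of
      \<open>p\<close>; for \<open>p = 0\<close> any level works.\<close>
    have "w \<in> lead_words (Max ((\<lambda>w. length (takeWhile ((=) Y) w)) ` Poly_Mapping.keys p))"
      if "w \<in> Poly_Mapping.keys p" for w
      using that assms(2) by (auto simp: lead_words_def H1_eq supported_def)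
    then show "p \<in> supported (lead_words (Max ((\<lambda>w. length (takeWhile ((=) Y) w)) ` Poly_Mapping.keys p)))"
      by (auto simp: supported_def)
  qed
qed

text \<open>The induction step common to both products. Here \<open>p\<close> is the word with
  \<open>Suc m\<close> leading \<open>Y\<close>, and \<open>h\<close> the product of
  \<open>Y\<close> with the word having one less: \<open>word [Y] * p\<close> adds one copy to the
  \<open>Suc m\<close> copies inside \<open>word [Y] * h\<close>.\<close>

lemma supported_lead_step:
  assumes "h - scalar (of_nat (Suc m)) * p \<in> supported (lead_words m)"
    and "q - (word [Y] * p + word [Y] * h) \<in> supported (lead_words (Suc m))"
  shows "q - scalar (of_nat (Suc (Suc m))) * (word [Y] * p) \<in> supported (lead_words (Suc m))"
proof -
  define r where "r = h - scalar (of_nat (Suc m)) * p"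
  then have h: "h = scalar (of_nat (Suc m)) * p + r" by simp
  have "scalar (of_nat (Suc (Suc m))) = 1 + scalar (of_nat (Suc m))"
    by (simp add: scalar_def single_add algebra_simps)
  moreover have "word [Y] * (scalar (of_nat (Suc m)) * p) = scalar (of_nat (Suc m)) * (word [Y] * p)"
    by (simp only: scalar_commute mult.assoc)
  ultimately have "q - scalar (of_nat (Suc (Suc m))) * (word [Y] * p)
      = (q - (word [Y] * p + word [Y] * h)) + word [Y] * r"
    by (simp add: h algebra_simps)
  moreover have "word [Y] * r \<in> supported (lead_words (Suc m))"
    using assms(1) unfolding r_def[symmetric] by (rule supported_word_mult) (simp add: Y_Cons_in_lead_words)
  ultimately show ?thesis using assms(2) by (simp only: supported_add)
qed

text \<open>Merged indices and the first index of \<open>ks\<close> are at least 2, so terms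
  beginning with them start with \<open>X\<close> and have level 0. What counts are the
  \<open>Suc m\<close> places for the new \<open>Y\<close> among the leading ones.\<close>

lemma nharm_index_lead:
  assumes "ks = [] \<or> hd ks \<ge> 2"
  shows "nharm_index [Suc 0] (replicate m (Suc 0) @ ks)
      - scalar (of_nat (Suc m)) * word (zword (replicate (Suc m) (Suc 0) @ ks))
    \<in> supported (lead_words m)"
proof (induction m)
  case 0
  show ?case
  proof (cases ks)
    case Nil
    then show ?thesis by (simp add: scalar_def zword_Cons)
  next
    case (Cons l ls)
    with assms have "l \<ge> 2" by simp
    have "word (zgen l) * nharm_index [Suc 0] ls \<in> supported (lead_words 0)"
      "word (zgen (Suc l)) * word (zword ls) \<in> supported (lead_words 0)"
      using \<open>l \<ge> 2\<close>
      by (auto intro!: supported_word_mult[OF nharm_index_supported] zgen_append_in_lead_words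
          supported_word_mult[OF supported_word[OF zword_in_H1_words]])
    moreover have "nharm_index [Suc 0] (replicate 0 (Suc 0) @ ks)
        - scalar (of_nat (Suc 0)) * word (zword (replicate (Suc 0) (Suc 0) @ ks))
      = word (zgen l) * nharm_index [Suc 0] ls - word (zgen (Suc l)) * word (zword ls)"
      by (simp add: Cons zword_Cons scalar_def word_append[symmetric])
    ultimately show ?thesis by (simp only: supported_diff)
  qed
next
  case (Suc m)
  let ?p = "word (zword (replicate (Suc m) (Suc 0) @ ks))"
  let ?h = "nharm_index [Suc 0] (replicate m (Suc 0) @ ks)"
  have "word (zgen 2) * word (zword (replicate m (Suc 0) @ ks)) \<in> supported (lead_words (Suc m))"
    by (rule supported_word_mult[OF supported_word[OF zword_in_H1_words]])
      (rule zgen_append_in_lead_words, auto)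
  then have "nharm_index [Suc 0] (replicate (Suc m) (Suc 0) @ ks) - (word [Y] * ?p + word [Y] * ?h)
      \<in> supported (lead_words (Suc m))"
    by (simp add: numeral_2_eq_2 supported_uminus)
  from supported_lead_step[OF Suc.IH this] show ?case
    by (simp add: zword_Cons word_append[symmetric])
qed

lemma triangular_nharm: "triangular nharm"
  unfolding triangular_def
proof (intro allI ballI)
  fix m v assume "v \<in> H0_words"
  then obtain ks where ks: "\<forall>k\<in>set ks. k \<ge> 1" "ks = [] \<or> hd ks \<ge> 2" "v = zword ks"
    by (rule H0_words_zword)
  have "nharm (word (zword [Suc 0])) (word (zword (replicate m (Suc 0) @ ks)))
      = nharm_index [Suc 0] (replicate m (Suc 0) @ ks)"
    using ks(1) by (intro nharm_zword) auto
  then show "nharm (word [Y]) (word (replicate m Y @ v))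
      - scalar (of_nat (Suc m)) * word (replicate (Suc m) Y @ v) \<in> supported (lead_words m)"
    using nharm_index_lead[OF ks(2), of m] by (simp add: ks(3) zword_replicate_1 zword_Cons)
qed

text \<open>The correction terms that occur start with \<open>tau Y = X\<close> and have level 0. As
  for the harmonic product, only the \<open>Suc m\<close> places for the new \<open>Y\<close>
  count.\<close>

lemma nshuffle_word_lead:
  assumes "v \<in> H0_words"
  shows "nshuffle_word [Y] (replicate m Y @ v)
      - scalar (of_nat (Suc m)) * word (replicate (Suc m) Y @ v)
    \<in> supported (lead_words m)"
proof (induction m)
  case 0
  show ?case
  proof (cases v)
    case Nil
    then show ?thesis by (simp add: scalar_def)
  next
    case (Cons b v')
    with assms have b: "b = X" "v' \<in> H1_words - {[]}"
      by (auto simp: H0_words_def H1_words_def split: if_splits)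
    then have "word [X] * nshuffle_word [Y] v' \<in> supported (lead_words 0)"
      by (intro supported_word_mult[OF nshuffle_word_supported])
        (auto intro!: X_Cons_in_lead_words simp: H1_words_def)
    moreover have "word (X # X # v') \<in> supported (lead_words 0)"
      using b by (intro supported_word) (auto intro!: X_Cons_in_lead_words simp: H1_words_def)
    moreover have "nshuffle_word [Y] (replicate 0 Y @ v)
        - scalar (of_nat (Suc 0)) * word (replicate (Suc 0) Y @ v)
      = word [X] * nshuffle_word [Y] v' - word (X # X # v')"
      using b by (simp add: Cons scalar_def delta_def word_append[symmetric])
    ultimately show ?thesis by (simp only: supported_diff)
  qed
next
  case (Suc m)
  let ?v = "replicate m Y @ v"
  have "X # Y # ?v \<in> lead_words (Suc m)" "[X, Y] \<in> lead_words (Suc m)"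
    using assms by (auto simp: lead_words_def H1_words_def H0_words_def last_append)
  then have "- word (X # Y # ?v) - scalar (delta ?v) * word [X, Y] \<in> supported (lead_words (Suc m))"
    by (intro supported_diff supported_uminus supported_scalar_mult supported_word)
  then have "nshuffle_word [Y] (replicate (Suc m) Y @ v)
      - (word [Y] * word (replicate (Suc m) Y @ v) + word [Y] * nshuffle_word [Y] ?v)
      \<in> supported (lead_words (Suc m))"
    by (simp add: scalar_def delta_def split: if_splits)
  from supported_lead_step[OF Suc.IH this] show ?case
    by (simp add: word_append[symmetric])
qed

lemma triangular_nshuffle: "triangular nshuffle"
  using nshuffle_word_lead by (simp add: triangular_def nshuffle_def bilinear_ext_word)

section \<open>Asymptotic regularization\<close>

text \<open>Decay against all powers of \<open>L\<close> at once, because the values to be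
  multiplied grow like polynomials in \<open>L\<close>; mere convergence to 0 would not survive
  that.\<close>

definition negligible :: "'x filter \<Rightarrow> ('x \<Rightarrow> real) \<Rightarrow> ('x \<Rightarrow> real) \<Rightarrow> bool" where
  "negligible F L e \<longleftrightarrow> (\<forall>k. ((\<lambda>x. e x * L x ^ k) \<longlongrightarrow> 0) F)"

lemma negligible_tendsto: "negligible F L e \<Longrightarrow> (e \<longlongrightarrow> 0) F"
  unfolding negligible_def by (drule spec[of _ 0]) simp

lemma negligible_add:
  "negligible F L e \<Longrightarrow> negligible F L e' \<Longrightarrow> negligible F L (\<lambda>x. e x + e' x)"
  unfolding negligible_def distrib_right using tendsto_add_zero by blast

lemma negligible_cmult: "negligible F L e \<Longrightarrow> negligible F L (\<lambda>x. c * e x)"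
  unfolding negligible_def mult.assoc using tendsto_mult_right_zero by blast

lemma negligible_diff:
  "negligible F L e \<Longrightarrow> negligible F L e' \<Longrightarrow> negligible F L (\<lambda>x. e x - e' x)"
  using negligible_add[of F L e "\<lambda>x. - 1 * e' x"] negligible_cmult[of F L e' "- 1"] by simp

lemma negligible_0: "negligible F L (\<lambda>x. 0)"
  by (simp add: negligible_def)

lemma negligible_cong:
  assumes "negligible F L e" "\<forall>\<^sub>F x in F. e x = e' x"
  shows "negligible F L e'"
  unfolding negligible_def
proof
  fix k
  have "((\<lambda>x. e x * L x ^ k) \<longlongrightarrow> 0) F" using assms(1) by (simp add: negligible_def)
  then show "((\<lambda>x. e' x * L x ^ k) \<longlongrightarrow> 0) F"
    by (rule Lim_transform_eventually) (use assms(2) in \<open>auto elim: eventually_mono\<close>)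
qed

lemma negligible_mult:
  assumes "negligible F L e" "negligible F L e'"
  shows "negligible F L (\<lambda>x. e x * e' x)"
  unfolding negligible_def
proof
  fix k
  have "((\<lambda>x. e' x * L x ^ k) \<longlongrightarrow> 0) F" using assms(2) by (simp add: negligible_def)
  with negligible_tendsto[OF assms(1)] have "((\<lambda>x. e x * (e' x * L x ^ k)) \<longlongrightarrow> 0) F"
    by (rule tendsto_mult_zero)
  then show "((\<lambda>x. e x * e' x * L x ^ k) \<longlongrightarrow> 0) F" by (simp add: mult.assoc)
qed

text \<open>A factor \<open>L\<close> is absorbed by raising the exponent in
  \<open>negligible\<close>.\<close>

lemma negligible_poly_mult:
  assumes "negligible F L e"
  shows "negligible F L (\<lambda>x. poly P (L x) * e x)"
proof (induction P)
  case (pCons a P)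
  have "negligible F L (\<lambda>x. L x * (poly P (L x) * e x))"
    unfolding negligible_def
  proof
    fix k
    have "((\<lambda>x. poly P (L x) * e x * L x ^ Suc k) \<longlongrightarrow> 0) F"
      using pCons.IH unfolding negligible_def by blast
    then show "((\<lambda>x. L x * (poly P (L x) * e x) * L x ^ k) \<longlongrightarrow> 0) F"
      by (simp add: mult_ac)
  qed
  from negligible_add[OF negligible_cmult[OF assms, of a] this] show ?case
    by (simp add: algebra_simps)
qed (simp add: negligible_0)

text \<open>Exponential decay beats every power. Both evaluations use \<open>c = 1/4\<close>: their
  errors are of order N^(-1/4) and (1-t)^(1/4), which are exponentials of logarithms.\<close>

lemma negligible_exp_bound:
  assumes "filterlim L at_top F" "c > 0" "\<forall>\<^sub>F x in F. \<bar>e x\<bar> \<le> C * exp (- c * L x)"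
  shows "negligible F L e"
  unfolding negligible_def
proof
  fix k
  have cL: "filterlim (\<lambda>x. c * L x) at_top F"
    using assms(1,2) filterlim_tendsto_pos_mult_at_top[OF tendsto_const[of c]] by blast
  have "((\<lambda>x. C / c ^ k * ((c * L x) ^ k / exp (c * L x))) \<longlongrightarrow> 0) F"
    by (intro tendsto_mult_right_zero filterlim_compose[OF tendsto_power_div_exp_0 cL])
  then have lim: "((\<lambda>x. C * exp (- c * L x) * L x ^ k) \<longlongrightarrow> 0) F"
    using assms(2) by (simp add: power_mult_distrib exp_minus field_simps)
  have "\<forall>\<^sub>F x in F. L x \<ge> 0"
    using assms(1) by (simp add: filterlim_at_top)
  with assms(3) have "\<forall>\<^sub>F x in F. norm (e x * L x ^ k) \<le> C * exp (- c * L x) * L x ^ k"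
    by eventually_elim (simp add: abs_mult mult_right_mono)
  then show "((\<lambda>x. e x * L x ^ k) \<longlongrightarrow> 0) F"
    using lim by (rule Lim_null_comparison)
qed

text \<open>With \<open>s\<close> the sign of the leading coefficient, \<open>smult s P\<close> is
  eventually at least its own leading coefficient, whether \<open>P\<close> is constant or not. The
  sign is kept for a one-sided Abel argument.\<close>

lemma eventually_abs_poly_ge:
  fixes P :: "real poly"
  assumes "filterlim L at_top F" "P \<noteq> 0"
  shows "\<exists>s\<in>{- 1, 1}. \<exists>c>0. \<forall>\<^sub>F x in F. s * poly P (L x) \<ge> c"
proof -
  define s :: real where "s = (if lead_coeff P > 0 then 1 else - 1)"
  have pos: "lead_coeff (smult s P) > 0"
    using assms(2) by (auto simp: s_def not_less less_le)
  then obtain n where n: "\<And>y. y \<ge> n \<Longrightarrow> poly (smult s P) y \<ge> lead_coeff (smult s P)"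
    using poly_pinfty_gt_lc[of "smult s P"] by auto
  have "\<forall>\<^sub>F x in F. L x \<ge> n"
    using assms(1) by (simp add: filterlim_at_top)
  then have "\<forall>\<^sub>F x in F. s * poly P (L x) \<ge> lead_coeff (smult s P)"
    by eventually_elim (use n in auto)
  with pos show ?thesis by (intro bexI[of _ s]) (auto simp: s_def)
qed

lemma poly_eq_0_if_tendsto_0:
  fixes P :: "real poly"
  assumes "filterlim L at_top F" "F \<noteq> bot" "((\<lambda>x. poly P (L x)) \<longlongrightarrow> 0) F"
  shows "P = 0"
proof (rule ccontr)
  assume "P \<noteq> 0"
  then obtain s c where s: "c > 0" "\<forall>\<^sub>F x in F. s * poly P (L x) \<ge> c"
    using eventually_abs_poly_ge[OF assms(1)] by blast
  have "((\<lambda>x. s * poly P (L x)) \<longlongrightarrow> 0) F"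
    using assms(3) by (rule tendsto_mult_right_zero)
  then have "c \<le> 0" using s(2) assms(2) by (rule tendsto_lowerbound)
  with s(1) show False by simp
qed

text \<open>An evaluation of words that is multiplicative for the product \<open>prd\<close>. Since the errors are
  smaller than every negative power of \<open>L\<close>, the polynomial expansions in \<open>L\<close> of the values on
  \<^const>\<open>H1\<close> multiply like the values, and they are the regularized values.\<close>

locale asymptotic_evaluation =
  fixes prd :: "ncpoly \<Rightarrow> ncpoly \<Rightarrow> ncpoly"
    and F :: "'x filter" and L :: "'x \<Rightarrow> real" and ev :: "letter list \<Rightarrow> 'x \<Rightarrow> real"
  assumes nontrivial: "F \<noteq> bot"
    and L_at_top: "filterlim L at_top F"
    and prd_in_H1: "p \<in> H1 \<Longrightarrow> q \<in> H1 \<Longrightarrow> prd p q \<in> H1"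
    and triangular: "triangular prd"
    and ev_prd: "p \<in> H1 \<Longrightarrow> q \<in> H1 \<Longrightarrow> \<forall>\<^sub>F x in F.
      lin_ext (\<lambda>w. ev w x) (prd p q) = lin_ext (\<lambda>w. ev w x) p * lin_ext (\<lambda>w. ev w x) q"
    and ev_Nil: "ev [] x = 1"
    and ev_Y: "\<forall>\<^sub>F x in F. ev [Y] x = L x"
    and ev_H0: "w \<in> H0_words \<Longrightarrow> negligible F L (\<lambda>x. ev w x - zeta_bar (index_of w))"
begin

definition expansion :: "ncpoly \<Rightarrow> real poly \<Rightarrow> bool" where
  "expansion p P \<longleftrightarrow> negligible F L (\<lambda>x. lin_ext (\<lambda>w. ev w x) p - poly P (L x))"

lemma expansion_unique:
  assumes "expansion p P" "expansion p Q"
  shows "P = Q"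
proof -
  have "negligible F L (\<lambda>x. poly (Q - P) (L x))"
    using negligible_diff[OF assms[unfolded expansion_def]] by simp
  then have "Q - P = 0"
    by (intro poly_eq_0_if_tendsto_0[OF L_at_top nontrivial] negligible_tendsto)
  then show ?thesis by simp
qed

lemma expansion_add: "expansion p P \<Longrightarrow> expansion q Q \<Longrightarrow> expansion (p + q) (P + Q)"
  unfolding expansion_def using negligible_add by (fastforce simp: lin_ext_add algebra_simps)

lemma expansion_scalar: "expansion p P \<Longrightarrow> expansion (scalar c * p) (smult (of_rat c) P)"
  unfolding expansion_def using negligible_cmult[of F L _ "of_rat c"]
  by (fastforce simp: lin_ext_scalar_mult algebra_simps)

text \<open>If e and e' are the errors of the factors, the product of the values differs from P Q by
  P e' + Q e + e e', which is again negligible.\<close>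

lemma expansion_prd:
  assumes "expansion p P" "expansion q Q" "p \<in> H1" "q \<in> H1"
  shows "expansion (prd p q) (P * Q)"
proof -
  let ?e = "\<lambda>x. lin_ext (\<lambda>w. ev w x) p - poly P (L x)"
  let ?e' = "\<lambda>x. lin_ext (\<lambda>w. ev w x) q - poly Q (L x)"
  have "negligible F L (\<lambda>x. (poly P (L x) * ?e' x + poly Q (L x) * ?e x) + ?e x * ?e' x)"
    using assms(1,2) unfolding expansion_def
    by (intro negligible_add negligible_poly_mult negligible_mult)
  then show ?thesis
    unfolding expansion_def
    by (rule negligible_cong) (use ev_prd[OF assms(3,4)] in \<open>auto elim!: eventually_mono simp: algebra_simps\<close>)
qed

lemma expansion_H0:
  assumes "p \<in> H0"
  shows "expansion p [:Zbar p:]"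
  using assms unfolding H0_eq
proof (induction rule: supported_induct)
  case zero
  then show ?case by (simp add: expansion_def Zbar_eq negligible_0)
next
  case (add p q)
  from expansion_add[OF add.IH] show ?case by (simp add: Zbar_eq lin_ext_add)
next
  case (word c w)
  then have "expansion (word w) [:Zbar (word w):]"
    using ev_H0 by (simp add: expansion_def Zbar_eq)
  from expansion_scalar[OF this] show ?case by (simp add: Zbar_eq lin_ext_scalar_mult)
qed

lemma word_Y_in_H1: "word [Y] \<in> H1"
  unfolding H1_eq by (intro supported_word) (simp add: H1_words_def)

lemma expansion_Y: "expansion (word [Y]) [:0, 1:]"
  unfolding expansion_def
  by (rule negligible_cong[OF negligible_0]) (use ev_Y in \<open>auto elim: eventually_mono\<close>)

lemma expansion_exists:
  assumes "p \<in> H1"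
  shows "\<exists>P. expansion p P"
  using triangular assms
proof (induction rule: H1_generated)
  case (mult_Y p)
  then show ?case using prd_in_H1 expansion_prd expansion_Y word_Y_in_H1 by blast
qed (use expansion_H0 expansion_add expansion_scalar in blast)+

text \<open>Sending \<open>p\<close> to its expansion polynomial is a homomorphism because
  expansions are unique, and it has the prescribed values on \<open>H0\<close> and \<open>Y\<close>.
  As these generate \<open>H1\<close>, it is the function singled out by \<open>THE\<close>.\<close>

lemma expansion_Zbar_ext:
  assumes "p \<in> H1"
  shows "expansion p (Zbar_ext prd p)"
proof -
  \<comment> \<open>\<open>restrict\<close> supplies the default value outside \<open>H1\<close>
    demanded by \<open>extensional\<close>.\<close>
  define f where "f = restrict (\<lambda>p. THE P. expansion p P) H1"
  have f: "expansion p (f p)" if "p \<in> H1" for p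
    using expansion_exists[OF that] expansion_unique that
    by (auto simp: f_def intro: theI2)
  have fI: "f p = P" if "p \<in> H1" "expansion p P" for p P
    using f that expansion_unique by blast
  have H0_H1: "p \<in> H1" if "p \<in> H0" for p
    using that H0_subset_H1 by blast
  have add: "p + q \<in> H1" if "p \<in> H1" "q \<in> H1" for p q
    using that by (auto simp: H1_eq)
  have scalar: "scalar c * p \<in> H1" if "p \<in> H1" for p c
    using that by (auto simp: H1_eq)
  have one: "1 \<in> H1"
    unfolding H1_eq word_Nil[symmetric] by (intro supported_word) simp
  have "expansion 1 1"
    unfolding expansion_def word_Nil[symmetric] by (simp add: ev_Nil negligible_0)
  have "H1_alg_hom prd f"
    unfolding H1_alg_hom_def
    using f fI add scalar prd_in_H1 expansion_add expansion_scalar expansion_prd one \<open>expansion 1 1\<close>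
    by meson
  have "Zbar_ext prd = f"
    unfolding Zbar_ext_def
  proof (rule the_equality)
    show "f \<in> extensional H1 \<and> H1_alg_hom prd f \<and> (\<forall>p\<in>H0. f p = [:Zbar p:]) \<and> f (word [Y]) = [:0, 1:]"
      using \<open>H1_alg_hom prd f\<close> H0_H1 fI expansion_H0 expansion_Y word_Y_in_H1
      by (auto simp: f_def)
  next
    fix g
    assume g: "g \<in> extensional H1 \<and> H1_alg_hom prd g \<and> (\<forall>p\<in>H0. g p = [:Zbar p:]) \<and> g (word [Y]) = [:0, 1:]"
    show "g = f"
    proof (rule extensionalityI)
      fix p assume "p \<in> H1"
      with triangular show "g p = f p"
      proof (induction rule: H1_generated)
        case (H0 p)
        then show ?case using g fI[OF H0_H1 expansion_H0] by simp
      next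
        case (mult_Y p)
        then show ?case
          using g \<open>H1_alg_hom prd f\<close> word_Y_in_H1 prd_in_H1 fI[OF word_Y_in_H1 expansion_Y]
          by (simp add: H1_alg_hom_def)
      qed (use g \<open>H1_alg_hom prd f\<close> in \<open>simp_all add: H1_alg_hom_def\<close>)
    qed (use g in \<open>simp_all add: f_def\<close>)
  qed
  with f assms show ?thesis by simp
qed

lemma Zbar_ext_eq_0:
  assumes "p \<in> H1" "((\<lambda>x. lin_ext (\<lambda>w. ev w x) p) \<longlongrightarrow> 0) F"
  shows "Zbar_ext prd p = 0"
proof (rule poly_eq_0_if_tendsto_0[OF L_at_top nontrivial])
  have "((\<lambda>x. lin_ext (\<lambda>w. ev w x) p - poly (Zbar_ext prd p) (L x)) \<longlongrightarrow> 0) F"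
    using expansion_Zbar_ext[OF assms(1)] unfolding expansion_def by (rule negligible_tendsto)
  from tendsto_diff[OF assms(2) this] show "((\<lambda>x. poly (Zbar_ext prd p) (L x)) \<longlongrightarrow> 0) F"
    by simp
qed

lemma Zbar_ext_nonzero_bound:
  assumes "p \<in> H1" "Zbar_ext prd p \<noteq> 0"
  shows "\<exists>s\<in>{- 1, 1}. \<exists>c>0. \<forall>\<^sub>F x in F. s * lin_ext (\<lambda>w. ev w x) p \<ge> c"
proof -
  obtain s c where s: "s \<in> {- 1, 1::real}" "c > 0"
    "\<forall>\<^sub>F x in F. s * poly (Zbar_ext prd p) (L x) \<ge> c"
    using eventually_abs_poly_ge[OF L_at_top assms(2)] by blast
  have "((\<lambda>x. lin_ext (\<lambda>w. ev w x) p - poly (Zbar_ext prd p) (L x)) \<longlongrightarrow> 0) F"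
    using expansion_Zbar_ext[OF assms(1)] unfolding expansion_def by (rule negligible_tendsto)
  \<comment> \<open>Half of the bound \<open>c\<close> is given up to absorb the error of the
    expansion.\<close>
  then have "\<forall>\<^sub>F x in F. \<bar>lin_ext (\<lambda>w. ev w x) p - poly (Zbar_ext prd p) (L x)\<bar> < c / 2"
    using s(2) by (auto simp: tendsto_iff dist_real_def dest: spec[of _ "c / 2"])
  with s(3) have "\<forall>\<^sub>F x in F. s * lin_ext (\<lambda>w. ev w x) p \<ge> c / 2"
    by eventually_elim (use s(1) in \<open>auto simp: abs_if split: if_splits\<close>)
  with s(1,2) show ?thesis by (intro bexI[of _ s] exI[of _ "c / 2"]) auto
qed

text \<open>Both terms have the expansion \<open>Zbar_ext prd p * [:Zbar q:]\<close>, so their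
  difference is negligible even if each diverges. The constant \<open>Zbar q\<close> does not depend
  on the product, which makes the two products comparable.\<close>

lemma tendsto_ev_prd_H0:
  assumes "p \<in> H1" "q \<in> H0"
  shows "((\<lambda>x. lin_ext (\<lambda>w. ev w x) (prd p q) - Zbar q * lin_ext (\<lambda>w. ev w x) p) \<longlongrightarrow> 0) F"
proof -
  have q: "q \<in> H1" using assms(2) H0_subset_H1 by blast
  have "negligible F L (\<lambda>x. lin_ext (\<lambda>w. ev w x) (prd p q)
      - poly (Zbar_ext prd p * [:Zbar q:]) (L x))"
    using expansion_prd[OF expansion_Zbar_ext[OF assms(1)] expansion_H0[OF assms(2)] assms(1) q]
    by (simp add: expansion_def)
  moreover have "negligible F L (\<lambda>x. Zbar q * (lin_ext (\<lambda>w. ev w x) p - poly (Zbar_ext prd p) (L x)))"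
    using expansion_Zbar_ext[OF assms(1)] unfolding expansion_def by (rule negligible_cmult)
  ultimately show ?thesis
    by (intro negligible_tendsto[of F L]) (drule (1) negligible_diff, simp add: algebra_simps)
qed

end

section \<open>Truncated sums\<close>

text \<open>The part of the zeta series whose largest variable is \<open>m\<close>: each letter
  contributes a factor 1/m, and \<open>Y\<close> also sums over the next variable. The empty word
  sits at \<open>m = 0\<close>, so its partial sums and power series are 1; nonempty words vanish
  there because division by 0 gives 0.\<close>

primrec coef :: "letter list \<Rightarrow> nat \<Rightarrow> real" where
  "coef [] m = (if m = 0 then 1 else 0)"
| "coef (c # w) m = (case c of X \<Rightarrow> coef w m | Y \<Rightarrow> \<Sum>i\<le>m. coef w i) / real m"

definition psum :: "letter list \<Rightarrow> nat \<Rightarrow> real" where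
  "psum w N = (\<Sum>m\<le>N. coef w m)"

lemma coef_X [simp]: "coef (X # w) m = coef w m / real m"
  by simp

lemma coef_Y [simp]: "coef (Y # w) m = psum w m / real m"
  by (simp add: psum_def)

declare coef.simps(2) [simp del]

lemma coef_nonneg: "coef w m \<ge> 0"
proof (induction w arbitrary: m)
  case (Cons c w)
  then show ?case by (cases c) (simp_all add: psum_def sum_nonneg)
qed simp

lemma coef_0: "w \<noteq> [] \<Longrightarrow> coef w 0 = 0"
  by (cases w) (simp_all add: coef.simps(2))

lemma psum_nonneg: "psum w N \<ge> 0"
  by (simp add: psum_def sum_nonneg coef_nonneg)

lemma psum_mono: "M \<le> N \<Longrightarrow> psum w M \<le> psum w N"
  unfolding psum_def by (intro sum_mono2) (auto simp: coef_nonneg)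

lemma psum_Nil [simp]: "psum [] N = 1"
  by (simp add: psum_def)

lemma sum_inverse_eq_harm: "(\<Sum>m\<le>N. 1 / real m) = harm N"
  by (induction N) (simp_all add: harm_expand harm_Suc inverse_eq_divide)

lemma psum_Y: "psum [Y] N = harm N"
  by (simp add: psum_def[of "[Y]"] sum_inverse_eq_harm)

lemma coef_zgen_append: "k \<ge> 1 \<Longrightarrow> coef (zgen k @ w) m = psum w m / real m ^ k"
  by (induction k rule: dec_induct) (simp_all add: zgen_Suc)

lemma psum_zgen_append: "k \<ge> 1 \<Longrightarrow> psum (zgen k @ w) N = (\<Sum>m\<le>N. psum w m / real m ^ k)"
  by (simp add: psum_def[of "zgen k @ w"] coef_zgen_append)

lemma lin_ext_psum_zgen_mult:
  assumes "k \<ge> 1"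
  shows "lin_ext (\<lambda>w. psum w N) (word (zgen k) * p)
    = (\<Sum>m\<le>N. lin_ext (\<lambda>w. psum w m) p / real m ^ k)"
proof -
  have "lin_ext (\<lambda>w. psum w N) (word (zgen k) * p)
      = lin_ext (\<lambda>w. \<Sum>m\<le>N. psum w m / real m ^ k) p"
    by (simp add: lin_ext_word_mult psum_zgen_append[OF assms])
  also have "\<dots> = (\<Sum>m\<le>N. lin_ext (\<lambda>w. psum w m) p / real m ^ k)"
    by (simp add: lin_ext_def sum_divide_distrib sum_distrib_left sum.swap[of _ "{..N}"])
  finally show ?thesis .
qed

text \<open>Discrete product rule: the last two partial sums of the product differ by the
  \<open>N\<close>-th summand, in which the diagonal \<open>u N * v N\<close>, counted twice, is
  subtracted once. This is the source of the index \<open>k + l\<close> in the harmonic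
  product.\<close>

lemma partial_sums_mult:
  fixes u v :: "nat \<Rightarrow> 'a::comm_ring_1"
  shows "(\<Sum>m\<le>N. u m * (\<Sum>i\<le>m. v i) + (\<Sum>i\<le>m. u i) * v m - u m * v m)
    = (\<Sum>i\<le>N. u i) * (\<Sum>i\<le>N. v i)"
  by (induction N) (simp_all add: algebra_simps)

lemma psum_nharm_index:
  assumes "\<forall>k\<in>set ks. k \<ge> 1" "\<forall>l\<in>set ls. l \<ge> 1"
  shows "lin_ext (\<lambda>w. psum w N) (nharm_index ks ls) = psum (zword ks) N * psum (zword ls) N"
  using assms
proof (induction ks ls arbitrary: N rule: nharm_index.induct)
  case (3 k ks l ls)
  let ?u = "\<lambda>m. psum (zword ks) m / real m ^ k"
  let ?v = "\<lambda>m. psum (zword ls) m / real m ^ l"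
  have U: "psum (zword (k # ks)) m = (\<Sum>i\<le>m. ?u i)"
    and V: "psum (zword (l # ls)) m = (\<Sum>i\<le>m. ?v i)" for m
    using 3 by (simp_all add: zword_Cons psum_zgen_append)
  have "lin_ext (\<lambda>w. psum w N) (nharm_index (k # ks) (l # ls))
      = (\<Sum>m\<le>N. ?u m * psum (zword (l # ls)) m + psum (zword (k # ks)) m * ?v m - ?u m * ?v m)"
    using 3 by (simp add: lin_ext_add lin_ext_diff lin_ext_psum_zgen_mult sum.distrib sum_subtractf
        power_add)
  also have "\<dots> = psum (zword (k # ks)) N * psum (zword (l # ls)) N"
    unfolding U V by (rule partial_sums_mult)
  finally show ?case .
qed simp_all

lemma psum_nharm:
  assumes "p \<in> H1" "q \<in> H1"
  shows "lin_ext (\<lambda>w. psum w N) (nharm p q) = lin_ext (\<lambda>w. psum w N) p * lin_ext (\<lambda>w. psum w N) q"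
  unfolding nharm_def using assms unfolding H1_eq
proof (rule lin_ext_bilinear_ext)
  fix u v assume "u \<in> H1_words" "v \<in> H1_words"
  then obtain ks ls where
    "\<forall>k\<in>set ks. k \<ge> 1" "u = zword ks" "\<forall>l\<in>set ls. l \<ge> 1" "v = zword ls"
    by (metis H1_words_zword)
  then show "lin_ext (\<lambda>w. psum w N) (nharm_index (index_of u) (index_of v)) = psum u N * psum v N"
    by (simp add: index_of_zword psum_nharm_index)
qed

section \<open>Growth of coefficients and truncated sums\<close>

lemma psum_le: "psum w N \<le> (1 + harm N) ^ length w"
proof (induction w)
  case (Cons c w)
  \<comment> \<open>A letter costs at most a factor \<open>harm N\<close> if it is \<open>Y\<close>
    and a factor 1 if it is \<open>X\<close>; the sum covers both.\<close>
  have "psum (c # w) N \<le> psum w N * (1 + harm N)"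
  proof (cases c)
    case X
    have "coef w m / real m \<le> coef w m" for m
      using coef_nonneg[of w m] by (cases "m = 0") (simp_all add: divide_le_eq mult_le_cancel_left1)
    then have "psum (c # w) N \<le> psum w N"
      unfolding X psum_def by (simp add: sum_mono)
    also have "\<dots> \<le> psum w N * (1 + harm N)"
      using psum_nonneg[of w N] harm_nonneg[of N, where 'a = real] by (simp add: mult_le_cancel_left1)
    finally show ?thesis .
  next
    case Y
    have "psum (c # w) N \<le> (\<Sum>m\<le>N. psum w N * (1 / real m))"
      unfolding Y psum_def[of "Y # w"] by (auto intro!: sum_mono divide_right_mono psum_mono)
    also have "\<dots> = psum w N * harm N"
      by (simp only: sum_distrib_left[symmetric] sum_inverse_eq_harm)
    also have "\<dots> \<le> psum w N * (1 + harm N)"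
      using psum_nonneg[of w N] by (intro mult_left_mono) auto
    finally show ?thesis .
  qed
  also have "\<dots> \<le> (1 + harm N) ^ length w * (1 + harm N)"
    using Cons.IH harm_nonneg[of N, where 'a = real] by (intro mult_right_mono) auto
  finally show ?case by (simp add: mult.commute)
qed simp

text \<open>The divisions coming from leading \<open>X\<close> are discarded; the first
  \<open>Y\<close>, which exists in a nonempty word of \<open>H1\<close>, brings the factor
  1/m.\<close>

lemma coef_le:
  assumes "w \<in> H1_words" "w \<noteq> []"
  shows "coef w m \<le> (1 + harm m) ^ length w / real m"
  using assms
proof (induction w)
  case (Cons c w)
  have harm: "harm m \<ge> (0::real)" by (rule harm_nonneg)
  have pow: "(1 + harm m) ^ length w \<le> (1 + harm m :: real) ^ length (c # w)"
    using harm by (intro power_increasing) auto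
  show ?case
  proof (cases c)
    case X
    with Cons.prems have "w \<in> H1_words" "w \<noteq> []"
      by (auto simp: H1_words_def split: if_splits)
    with Cons.IH have IH: "coef w m \<le> (1 + harm m) ^ length w / real m" by simp
    have "coef w m / real m \<le> coef w m"
      using coef_nonneg[of w m] by (cases "m = 0") (simp_all add: divide_le_eq mult_le_cancel_left1)
    also note IH
    also have "(1 + harm m) ^ length w / real m \<le> (1 + harm m) ^ length (c # w) / real m"
      using pow by (rule divide_right_mono) simp
    finally show ?thesis by (simp add: X)
  next
    case Y
    have "psum w m \<le> (1 + harm m) ^ length (c # w)"
      using psum_le pow by (rule order_trans)
    then show ?thesis unfolding Y by (simp add: divide_right_mono)
  qed
qed simp

lemma power_le_fact_mult_exp:
  fixes x :: real
  assumes "x \<ge> 0"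
  shows "x ^ n \<le> fact n * exp x"
proof -
  have "(\<Sum>k\<in>{n}. x ^ k /\<^sub>R fact k) \<le> suminf (\<lambda>k. x ^ k /\<^sub>R fact k)"
    using assms by (intro sum_le_suminf summable_exp_generic) auto
  then show ?thesis by (simp add: exp_def field_simps)
qed

lemma harm_le_ln: "m \<ge> 1 \<Longrightarrow> harm m \<le> ln (real m) + 1"
  using decseqD[OF decseq_harm_diff_ln, of 0 "m - 1"] by (simp add: harm_expand)

text \<open>Halving the base before the comparison with the exponential turns ln m into (ln m)/2,
  whence the exponent 1/2.\<close>

lemma power_harm_le:
  "\<exists>C\<ge>0. \<forall>m\<ge>1. (1 + harm m :: real) ^ n \<le> C * real m powr (1/2)"
proof (intro exI conjI allI impI)
  show "(fact n * 2 ^ n * exp 1 :: real) \<ge> 0" by simp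
  fix m :: nat assume "m \<ge> 1"
  have "((1 + harm m) / 2) ^ n \<le> fact n * exp ((1 + harm m) / 2 :: real)"
    using harm_nonneg[of m, where 'a = real] by (intro power_le_fact_mult_exp) simp
  then have "(1 + harm m) ^ n \<le> fact n * 2 ^ n * exp ((1 + harm m) / 2 :: real)"
    by (simp add: power_divide field_simps)
  also have "exp ((1 + harm m) / 2 :: real) \<le> exp (1 + ln (real m) / 2)"
    using harm_le_ln[of m] \<open>m \<ge> 1\<close> by simp
  also have "\<dots> = exp 1 * real m powr (1/2)"
    using \<open>m \<ge> 1\<close> by (simp add: powr_def exp_add)
  finally show "(1 + harm m) ^ n \<le> fact n * 2 ^ n * exp 1 * real m powr (1/2)"
    by (simp add: mult_ac)
qed

lemma coef_bounded:
  assumes "w \<in> H1_words"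
  obtains C where "\<And>m. coef w m \<le> C"
proof (cases "w = []")
  case True
  with that[of 1] show ?thesis by simp
next
  case False
  obtain C :: real where C: "C \<ge> 0" "\<forall>m\<ge>1. (1 + harm m) ^ length w \<le> C * real m powr (1/2)"
    using power_harm_le by metis
  have "coef w m \<le> C" for m
  proof (cases "m = 0")
    case True
    with False C show ?thesis by (simp add: coef_0)
  next
    case m: False
    have "coef w m \<le> C * real m powr (1/2) / real m"
      using coef_le[OF assms False, of m] C(2)[rule_format, of m] m by (auto elim!: order_trans intro!: divide_right_mono)
    also have "real m powr (1/2) \<le> real m powr 1"
      using m by (intro powr_mono) auto
    then have "C * real m powr (1/2) / real m \<le> C"
      using m C(1) by (simp add: divide_le_eq mult_left_mono)
    finally show ?thesis .
  qed
  with that show ?thesis by blast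
qed

text \<open>The leading \<open>X\<close> gives a second factor 1/m, so the coefficients are
  O(m^(-3/2)) and leave room for the weight m^(1/4). This weight provides the rates of convergence
  both in \<open>N\<close> and in \<open>1 - t\<close>.\<close>

lemma summable_root_coef:
  assumes "w \<in> H0_words"
  shows "summable (\<lambda>m. real m powr (1/4) * coef w m)"
proof (cases w)
  case Nil
  have "summable (\<lambda>m. if m = 0 then real m powr (1/4) * coef w m else 0)"
    by (rule summable_finite[of "{0}"]) auto
  then show ?thesis
    by (rule summable_cong[THEN iffD1, rotated]) (simp add: Nil)
next
  case (Cons c v)
  with assms have w: "w = X # v" "v \<in> H1_words" "v \<noteq> []"
    by (auto simp: H0_words_def H1_words_def split: if_splits)
  obtain C :: real where C: "C \<ge> 0" "\<forall>m\<ge>1. (1 + harm m) ^ length v \<le> C * real m powr (1/2)"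
    using power_harm_le by metis
  have "summable (\<lambda>m. C * real m powr (-5/4))"
    by (intro summable_mult) (simp add: summable_real_powr_iff)
  then show ?thesis
  proof (rule summable_comparison_test'[where N = 1])
    fix m :: nat assume m: "m \<ge> 1"
    have "coef w m = coef v m / real m" by (simp add: w)
    also have "\<dots> \<le> (1 + harm m) ^ length v / real m / real m"
      using coef_le[OF w(2,3)] by (rule divide_right_mono) simp
    also have "\<dots> \<le> C * real m powr (1/2) / real m / real m"
      using C(2)[rule_format, OF m] by (intro divide_right_mono) auto
    also have "\<dots> = C * real m powr (-3/2)"
      using m by (simp add: powr_diff[of "real m" "1/2" 2, simplified] power2_eq_square)
    finally have "real m powr (1/4) * coef w m \<le> real m powr (1/4) * (C * real m powr (-3/2))"
      by (rule mult_left_mono) simp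
    also have "\<dots> = C * real m powr (-5/4)"
      by (simp add: powr_add[symmetric])
    finally show "norm (real m powr (1/4) * coef w m) \<le> C * real m powr (-5/4)"
      using coef_nonneg[of w m] by simp
  qed
qed

lemma summable_coef:
  assumes "w \<in> H0_words"
  shows "summable (coef w)"
  using summable_root_coef[OF assms]
proof (rule summable_comparison_test'[where N = 1])
  fix m :: nat assume "m \<ge> 1"
  then have "1 \<le> real m powr (1/4)" by (simp add: ge_one_powr_ge_zero)
  then show "norm (coef w m) \<le> real m powr (1/4) * coef w m"
    using coef_nonneg[of w m] by (simp add: mult_le_cancel_right1)
qed

text \<open>In the tail m > N, the inequality 1 \<le> N^(-1/4) m^(1/4) inserts the summable weight
  and pulls out the decay.\<close>

lemma psum_error:
  assumes "w \<in> H0_words" "N \<ge> 1"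
  shows "\<bar>psum w N - suminf (coef w)\<bar> \<le> suminf (\<lambda>m. real m powr (1/4) * coef w m) * real N powr (-1/4)"
proof -
  let ?g = "\<lambda>m. real m powr (1/4) * coef w m"
  have sum: "summable (coef w)" "summable ?g"
    using assms summable_coef summable_root_coef by auto
  note shift = summable_ignore_initial_segment[OF sum(1), of "Suc N"]
    summable_ignore_initial_segment[OF sum(2), of "Suc N"]
  have "suminf (coef w) - psum w N = suminf (\<lambda>m. coef w (m + Suc N))"
    using suminf_split_initial_segment[OF sum(1), of "Suc N"]
    by (simp add: psum_def lessThan_Suc_atMost)
  also have "\<dots> \<le> suminf (\<lambda>m. real N powr (-1/4) * ?g (m + Suc N))"
  proof (rule suminf_le)
    fix m
    have "real N powr (1/4) \<le> real (m + Suc N) powr (1/4)"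
      by (rule powr_mono2) auto
    then have "1 \<le> real N powr (-1/4) * real (m + Suc N) powr (1/4)"
      using assms(2) by (simp add: powr_minus field_simps)
    then show "coef w (m + Suc N) \<le> real N powr (-1/4) * ?g (m + Suc N)"
      using coef_nonneg[of w "m + Suc N"] by (simp add: mult_le_cancel_right1 mult.assoc[symmetric] del: of_nat_add)
  qed (rule shift summable_mult)+
  also have "\<dots> = real N powr (-1/4) * suminf (\<lambda>m. ?g (m + Suc N))"
    using shift(2) by (rule suminf_mult)
  also have "suminf (\<lambda>m. ?g (m + Suc N)) \<le> suminf (\<lambda>m. ?g m)"
    using suminf_split_initial_segment[OF sum(2), of "Suc N"] sum_nonneg[of "{..<Suc N}" ?g]
    by (simp add: coef_nonneg)
  finally have "suminf (coef w) - psum w N \<le> real N powr (-1/4) * suminf ?g"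
    by (simp add: mult_left_mono)
  moreover have "psum w N \<le> suminf (coef w)"
    unfolding psum_def using sum(1) by (intro sum_le_suminf) (auto simp: coef_nonneg)
  ultimately show ?thesis by (simp add: mult.commute)
qed

section \<open>Zeta values as limits of truncated sums\<close>

lemma psum_tendsto: "w \<in> H0_words \<Longrightarrow> psum w \<longlonglongrightarrow> suminf (coef w)"
  unfolding psum_def[abs_def] by (rule summable_LIMSEQ'[OF summable_coef])

text \<open>Fixing the head \<open>m\<close> leaves a decreasing list bounded by \<open>m\<close>,
  so the bound \<open>N\<close> has to vary in the induction.\<close>

lemma sum_decreasing_lists:
  assumes "\<forall>k\<in>set ks. k \<ge> 1"
  shows "finite {ms. length ms = length ks \<and> sorted_wrt (\<ge>) ms \<and> set ms \<subseteq> {1..N}} \<and>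
    (\<Sum>ms | length ms = length ks \<and> sorted_wrt (\<ge>) ms \<and> set ms \<subseteq> {1..N}.
      \<Prod>i<length ks. 1 / real (ms ! i) ^ (ks ! i)) = psum (zword ks) N"
  using assms
proof (induction ks arbitrary: N)
  case Nil
  have "{ms::nat list. length ms = length [] \<and> sorted_wrt (\<ge>) ms \<and> set ms \<subseteq> {1..N}} = {[]}" by auto
  then show ?case by simp
next
  case (Cons k ks)
  let ?M = "\<lambda>ks N. {ms::nat list. length ms = length ks \<and> sorted_wrt (\<ge>) ms \<and> set ms \<subseteq> {1..N}}"
  let ?f = "\<lambda>ks ms. \<Prod>i<length ks. 1 / real (ms ! i) ^ (ks ! i)"
  have fin: "finite (?M ks m)" and IH: "sum (?f ks) (?M ks m) = psum (zword ks) m" for m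
    using Cons by auto
  have M: "?M (k # ks) N = (\<lambda>(m, ms). m # ms) ` (SIGMA m:{1..N}. ?M ks m)" (is "?A = ?B")
  proof (intro equalityI subsetI)
    fix ms assume "ms \<in> ?A"
    then obtain m ms' where "ms = m # ms'" "length ms' = length ks" "sorted_wrt (\<ge>) ms'"
      "m \<in> {1..N}" "\<forall>x\<in>set ms'. x \<le> m" "set ms' \<subseteq> {1..N}"
      by (cases ms) auto
    then have "ms = m # ms'" "(m, ms') \<in> (SIGMA m:{1..N}. ?M ks m)"
      by auto
    then show "ms \<in> ?B" by force
  qed fastforce
  have "sum (?f (k # ks)) (?M (k # ks) N)
      = (\<Sum>(m, ms)\<in>(SIGMA m:{1..N}. ?M ks m). 1 / real m ^ k * ?f ks ms)"
    unfolding M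
    by (subst sum.reindex)
      (auto simp: inj_on_def prod.lessThan_Suc_shift intro!: sum.cong simp del: prod.lessThan_Suc)
  also have "\<dots> = (\<Sum>m=1..N. 1 / real m ^ k * sum (?f ks) (?M ks m))"
    using fin by (subst sum.Sigma[symmetric]) (auto simp: sum_distrib_left)
  also have "\<dots> = (\<Sum>m\<in>{1..N}. psum (zword ks) m / real m ^ k)"
    unfolding IH by simp
  \<comment> \<open>The index 0 may be added: as \<open>k \<ge> 1\<close>, its term is a division by
    0, hence 0.\<close>
  also have "\<dots> = (\<Sum>m\<le>N. psum (zword ks) m / real m ^ k)"
    using Cons.prems by (intro sum.mono_neutral_left) (auto simp: not_le)
  also have "\<dots> = psum (zword (k # ks)) N"
    using Cons.prems by (simp add: zword_Cons psum_zgen_append)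
  finally have "sum (?f (k # ks)) (?M (k # ks) N) = psum (zword (k # ks)) N" .
  moreover have "finite (?M (k # ks) N)"
    unfolding M using fin by (intro finite_imageI finite_SigmaI) auto
  ultimately show ?case by blast
qed

text \<open>Every finite subset of the index set \<open>A\<close> lies in some \<open>M N\<close>;
  as the terms are nonnegative, the unordered sum is the limit of the truncated sums.\<close>

lemma zeta_bar_eq:
  assumes "w \<in> H0_words"
  shows "zeta_bar (index_of w) = suminf (coef w)"
proof -
  obtain ks where ks: "\<forall>k\<in>set ks. k \<ge> 1" "w = zword ks"
    using H0_words_zword[OF assms] by metis
  define A where "A = {ms. length ms = length ks \<and> sorted_wrt (\<ge>) ms \<and> (\<forall>m\<in>set ms. m > (0::nat))}"
  define M where "M N = {ms. length ms = length ks \<and> sorted_wrt (\<ge>) ms \<and> set ms \<subseteq> {1..N}}" for N :: nat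
  define f where "f ms = (\<Prod>i<length ks. 1 / real (ms ! i) ^ (ks ! i))" for ms
  have fin: "finite (M N)" and sum_M: "sum f (M N) = psum w N" for N
    using sum_decreasing_lists[OF ks(1), of N] by (auto simp: M_def f_def[abs_def] ks(2))
  have f_nonneg: "f ms \<ge> 0" for ms by (simp add: f_def prod_nonneg)
  have MA: "M N \<subseteq> A" for N by (auto simp: M_def A_def)
  have bound: "sum f B \<le> suminf (coef w)" if B: "finite B" "B \<subseteq> A" for B
  proof -
    \<comment> \<open>A crude common bound for all entries: the sum of all entries of all lists in
      \<open>B\<close>.\<close>
    have "ms \<in> M (\<Sum>ms\<in>B. sum_list ms)" if "ms \<in> B" for ms
    proof -
      have "m \<le> (\<Sum>ms\<in>B. sum_list ms)" if "m \<in> set ms" for m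
        using member_le_sum_list[OF that] member_le_sum[OF \<open>ms \<in> B\<close>, of sum_list] B(1) by simp
      with that B(2) show ?thesis by (fastforce simp: M_def A_def)
    qed
    then have "sum f B \<le> sum f (M (\<Sum>ms\<in>B. sum_list ms))"
      using fin f_nonneg by (intro sum_mono2) auto
    also have "\<dots> \<le> suminf (coef w)"
      unfolding sum_M psum_def
      using summable_coef[OF assms] by (intro sum_le_suminf) (auto simp: coef_nonneg)
    finally show ?thesis .
  qed
  have summable: "f summable_on A"
    using bound f_nonneg by (intro nonneg_bdd_above_summable_on bdd_aboveI) auto
  have "infsum f A = suminf (coef w)"
  proof (rule antisym)
    show "infsum f A \<le> suminf (coef w)"
      using summable bound by (rule infsum_le_finite_sums)
    have "psum w N \<le> infsum f A" for N
      unfolding sum_M[symmetric]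
      using summable fin MA f_nonneg by (intro finite_sum_le_infsum) auto
    then show "suminf (coef w) \<le> infsum f A"
      by (intro LIMSEQ_le_const2[OF psum_tendsto[OF assms]]) auto
  qed
  then show ?thesis
    by (simp add: ks(2) index_of_zword[OF ks(1)] zeta_bar_def A_def f_def[abs_def])
qed

interpretation nharm: asymptotic_evaluation nharm sequentially harm psum
proof
  fix w assume w: "w \<in> H0_words"
  define D where "D = suminf (\<lambda>m. real m powr (1/4) * coef w m)"
  have D: "D \<ge> 0"
    unfolding D_def using summable_root_coef[OF w] by (intro suminf_nonneg) (auto simp: coef_nonneg)
  show "negligible sequentially harm (\<lambda>N. psum w N - zeta_bar (index_of w))"
  proof (rule negligible_exp_bound[OF harm_at_top])
    show "\<forall>\<^sub>F N in sequentially. \<bar>psum w N - zeta_bar (index_of w)\<bar>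
        \<le> D * exp (1/4) * exp (- (1/4) * harm N)"
      using eventually_ge_at_top[of 1]
    proof eventually_elim
      case (elim N)
      have "\<bar>psum w N - zeta_bar (index_of w)\<bar> \<le> D * real N powr (-1/4)"
        using psum_error[OF w elim] by (simp add: zeta_bar_eq[OF w] D_def)
      \<comment> \<open>The shift by 1 in \<open>harm_le_ln\<close> is the origin of the factor
        \<open>exp (1/4)\<close>.\<close>
      also have "real N powr (-1/4) \<le> exp (1/4) * exp (- (1/4) * harm N)"
        using elim harm_le_ln[of N] by (simp add: powr_def exp_add[symmetric])
      then have "D * real N powr (-1/4) \<le> D * exp (1/4) * exp (- (1/4) * harm N)"
        using D mult_left_mono[of "real N powr (-1/4)" _ D] by (simp add: mult.assoc)
      finally show ?case .
    qed
  qed simp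
qed (simp_all add: harm_at_top nharm_in_H1 triangular_nharm psum_nharm psum_Y)

section \<open>Polylogarithms\<close>

text \<open>A formal series, so that the shuffle identity can be proved by formal differentiation
  and evaluated afterwards.\<close>

definition coef_fps :: "ncpoly \<Rightarrow> real fps" where
  "coef_fps p = Abs_fps (\<lambda>m. lin_ext (\<lambda>w. coef w m) p)"

definition euler_deriv :: "real fps \<Rightarrow> real fps" where
  "euler_deriv f = fps_X * fps_deriv f"

definition polylog :: "letter list \<Rightarrow> real \<Rightarrow> real" where
  "polylog w t = suminf (\<lambda>m. coef w m * t ^ m)"

lemma coef_fps_add: "coef_fps (p + q) = coef_fps p + coef_fps q"
  by (simp add: fps_eq_iff coef_fps_def lin_ext_add)

lemma coef_fps_diff: "coef_fps (p - q) = coef_fps p - coef_fps q"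
  by (simp add: fps_eq_iff coef_fps_def lin_ext_diff)

lemma coef_fps_scalar_mult: "coef_fps (scalar c * p) = fps_const (of_rat c) * coef_fps p"
  by (simp add: fps_eq_iff coef_fps_def lin_ext_scalar_mult)

lemma coef_fps_Nil: "coef_fps (word []) = 1"
  by (simp add: fps_eq_iff coef_fps_def)

lemma coef_fps_nth_0:
  assumes "p \<in> supported (A - {[]})"
  shows "fps_nth (coef_fps p) 0 = 0"
proof -
  have "lin_ext (\<lambda>w. coef w 0) p = lin_ext (\<lambda>_. 0) p"
    using assms by (rule lin_ext_cong) (simp add: coef_0)
  then show ?thesis by (simp add: coef_fps_def lin_ext_def)
qed

lemma euler_deriv_nth: "fps_nth (euler_deriv f) m = real m * fps_nth f m"
  by (cases m) (simp_all add: euler_deriv_def)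

lemma euler_deriv_add: "euler_deriv (f + g) = euler_deriv f + euler_deriv g"
  by (simp add: euler_deriv_def algebra_simps)

lemma euler_deriv_diff: "euler_deriv (f - g) = euler_deriv f - euler_deriv g"
  by (simp add: euler_deriv_def algebra_simps)

lemma euler_deriv_mult: "euler_deriv (f * g) = euler_deriv f * g + f * euler_deriv g"
  by (simp add: euler_deriv_def algebra_simps)

lemma euler_deriv_const_mult: "euler_deriv (fps_const c * f) = fps_const c * euler_deriv f"
  by (simp add: fps_eq_iff euler_deriv_nth)

lemma euler_deriv_inject:
  assumes "euler_deriv f = euler_deriv g" "fps_nth f 0 = fps_nth g 0"
  shows "f = g"
proof (rule fps_ext)
  fix m
  have "real m * fps_nth f m = real m * fps_nth g m"
    using assms(1) by (metis euler_deriv_nth)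
  then show "fps_nth f m = fps_nth g m" using assms(2) by (cases "m = 0") auto
qed

text \<open>The differential forms of the letters: \<open>dt/t\<close> for \<open>x\<close> and \<open>dt/(t(1-t))\<close> for \<open>y\<close>, divided
  by \<open>dt/t\<close>. Only the last letter \<open>y\<close> of a word carries the form \<open>dt/(1-t)\<close>, which is the
  difference of the two; this is where the correction terms of the shuffle product come from.\<close>

fun form :: "letter \<Rightarrow> real fps" where
  "form X = 1"
| "form Y = Abs_fps (\<lambda>_. 1)"

lemma form_mult_nth:
  "fps_nth (form c * f) m = (case c of X \<Rightarrow> fps_nth f m | Y \<Rightarrow> \<Sum>i\<le>m. fps_nth f i)"
  by (cases c) (simp_all add: mult.commute[of _ f] fps_mult_nth atLeast0AtMost)

text \<open>The division in \<open>coef\<close> forgets the value at \<open>m = 0\<close>, which is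
  harmless if \<open>w\<close> is nonempty, since both sides are then 0. The excluded empty word is
  the origin of the \<open>delta\<close> terms.\<close>

lemma mult_coef_Cons:
  "w \<noteq> [] \<Longrightarrow> real m * coef (c # w) m = (case c of X \<Rightarrow> coef w m | Y \<Rightarrow> psum w m)"
  by (cases "m = 0") (auto simp: coef_0 psum_def coef.simps(2) split: letter.split)

lemma euler_deriv_letter_mult:
  assumes "p \<in> supported (A - {[]})"
  shows "euler_deriv (coef_fps (word [c] * p)) = form c * coef_fps p"
proof (rule fps_ext)
  fix m
  have "fps_nth (euler_deriv (coef_fps (word [c] * p))) m = real m * lin_ext (\<lambda>w. coef (c # w) m) p"
    by (simp add: euler_deriv_nth coef_fps_def lin_ext_word_mult)
  also have "\<dots> = lin_ext (\<lambda>w. real m * coef (c # w) m) p"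
    by (simp add: lin_ext_def sum_distrib_left mult_ac)
  also have "\<dots> = lin_ext (\<lambda>w. case c of X \<Rightarrow> coef w m | Y \<Rightarrow> psum w m) p"
    using assms by (rule lin_ext_cong) (rule mult_coef_Cons, simp)
  also have "\<dots> = fps_nth (form c * coef_fps p) m"
    unfolding form_mult_nth
    by (cases c) (simp_all add: coef_fps_def psum_def lin_ext_def sum_distrib_left sum.swap[of _ "{..m}"])
  finally show "fps_nth (euler_deriv (coef_fps (word [c] * p))) m = fps_nth (form c * coef_fps p) m" .
qed

text \<open>In the boundary case \<open>w = []\<close>, \<open>c = Y\<close> the series is -ln(1-t),
  and t d/dt of it is t/(1-t) = 1/(1-t) - 1, that is, \<open>form Y - form (tau Y)\<close>.\<close>

lemma euler_deriv_word_Cons: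
  assumes "c # w \<in> H1_words"
  shows "euler_deriv (coef_fps (word (c # w)))
    = form c * coef_fps (word w) - fps_const (of_rat (delta w)) * form (tau c)"
proof (cases "w = []")
  case True
  with assms have "c = Y" by (simp add: H1_words_def)
  have "fps_nth (euler_deriv (coef_fps (word [Y]))) m = fps_nth (form Y - 1) m" for m
    by (cases "m = 0") (simp_all add: euler_deriv_nth coef_fps_def)
  then show ?thesis
    by (simp add: fps_eq_iff True \<open>c = Y\<close> coef_fps_Nil delta_def)
next
  case False
  then have "word w \<in> supported (UNIV - {[]})" by auto
  from euler_deriv_letter_mult[OF this, of c] show ?thesis
    using False by (simp add: word_append[symmetric] delta_def)
qed

text \<open>By the Leibniz rule and \<open>euler_deriv_word_Cons\<close>, the Euler derivative of
  the product has the same terms as that of the recursion of \<open>nshuffle_word\<close>,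
  corrections included. For two nonempty words both sides have constant term 0, so they
  agree.\<close>

lemma coef_fps_nshuffle_word:
  "u \<in> H1_words \<Longrightarrow> v \<in> H1_words
    \<Longrightarrow> coef_fps (nshuffle_word u v) = coef_fps (word u) * coef_fps (word v)"
proof (induction u v rule: nshuffle_word.induct)
  case (3 a u b v)
  have uv: "u \<in> H1_words" "v \<in> H1_words"
    using 3 by (blast dest: Cons_in_H1_words)+
  have "euler_deriv (coef_fps (nshuffle_word (a # u) (b # v)))
      = form a * coef_fps (nshuffle_word u (b # v)) + form b * coef_fps (nshuffle_word (a # u) v)
        - fps_const (of_rat (delta u)) * (form (tau a) * coef_fps (word (b # v)))
        - fps_const (of_rat (delta v)) * (form (tau b) * coef_fps (word (a # u)))"
  proof -
    have "word (c # d # w) = word [c] * word (d # w)" for c d w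
      by (simp add: word_append[symmetric])
    moreover have "euler_deriv (coef_fps (word [c] * word (d # w))) = form c * coef_fps (word (d # w))"
      for c d w
      by (rule euler_deriv_letter_mult[where A = UNIV]) auto
    moreover have "nshuffle_word u (b # v) \<in> supported (H1_words - {[]})"
      "nshuffle_word (a # u) v \<in> supported (H1_words - {[]})"
      using nshuffle_word_supported uv 3 by auto
    ultimately show ?thesis
      by (simp add: coef_fps_add coef_fps_diff coef_fps_scalar_mult euler_deriv_add euler_deriv_diff
          euler_deriv_const_mult euler_deriv_letter_mult)
  qed
  also have "\<dots> = euler_deriv (coef_fps (word (a # u)) * coef_fps (word (b # v)))"
    using 3 uv by (simp add: euler_deriv_mult euler_deriv_word_Cons algebra_simps)
  finally show ?case
  proof (rule euler_deriv_inject)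
    have "nshuffle_word (a # u) (b # v) \<in> supported (H1_words - {[]})"
      using 3 by (intro nshuffle_word_supported) auto
    moreover have "word (a # u) \<in> supported (UNIV - {[]})" by auto
    ultimately show "fps_nth (coef_fps (nshuffle_word (a # u) (b # v))) 0
        = fps_nth (coef_fps (word (a # u)) * coef_fps (word (b # v))) 0"
      by (simp add: coef_fps_nth_0 del: nshuffle_word.simps)
  qed
qed (simp_all add: coef_fps_Nil)

section \<open>Convergence and evaluation for \<open>\<bar>t\<bar> < 1\<close>\<close>

lemma summable_coef_power:
  assumes "w \<in> H1_words" "\<bar>t\<bar> < 1"
  shows "summable (\<lambda>m. coef w m * t ^ m)"
proof -
  obtain C where C: "\<And>m. coef w m \<le> C"
    using coef_bounded[OF assms(1)] by blast
  have "summable (\<lambda>m. C * \<bar>t\<bar> ^ m)"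
    using assms(2) by (intro summable_mult summable_geometric) auto
  then show ?thesis
    by (rule summable_comparison_test'[where N = 0])
      (use C in \<open>auto simp: abs_mult power_abs coef_nonneg intro!: mult_right_mono\<close>)
qed

lemma sums_lin_ext_coef:
  assumes "p \<in> H1" "\<bar>t\<bar> < 1"
  shows "(\<lambda>m. lin_ext (\<lambda>w. coef w m) p * t ^ m) sums lin_ext (\<lambda>w. polylog w t) p"
  using assms(1) unfolding H1_eq
proof (induction rule: supported_induct)
  case (add p q)
  then show ?case using sums_add by (simp add: lin_ext_add distrib_right)
next
  case (word c w)
  have "(\<lambda>m. coef w m * t ^ m) sums polylog w t"
    unfolding polylog_def using summable_coef_power[OF word assms(2)] by (rule summable_sums)
  then have "(\<lambda>m. of_rat c * (coef w m * t ^ m)) sums (of_rat c * polylog w t)"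
    by (rule sums_mult)
  then show ?case by (simp add: lin_ext_scalar_mult mult.assoc)
qed simp

lemma fps_conv_radius_ge_1:
  fixes f :: "real fps"
  assumes "\<And>t. \<bar>t\<bar> < 1 \<Longrightarrow> summable (\<lambda>m. fps_nth f m * t ^ m)"
  shows "fps_conv_radius f \<ge> 1"
  unfolding fps_conv_radius_def
proof (rule conv_radius_geI_ex)
  fix r :: real assume "0 < r" "ereal r < 1"
  with assms[of r] show "\<exists>z. norm z = r \<and> summable (\<lambda>n. fps_nth f n * z ^ n)"
    by (intro exI[of _ r]) auto
qed

lemma eval_coef_fps:
  assumes "p \<in> H1" "\<bar>t\<bar> < 1"
  shows "eval_fps (coef_fps p) t = lin_ext (\<lambda>w. polylog w t) p"
  using sums_lin_ext_coef[OF assms] by (simp add: eval_fps_def coef_fps_def sums_iff)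

lemma fps_conv_radius_coef_fps:
  assumes "p \<in> H1"
  shows "fps_conv_radius (coef_fps p) \<ge> 1"
  by (rule fps_conv_radius_ge_1)
    (use sums_lin_ext_coef[OF assms] in \<open>auto simp: coef_fps_def sums_iff\<close>)

lemma polylog_nshuffle:
  assumes "p \<in> H1" "q \<in> H1" "\<bar>t\<bar> < 1"
  shows "lin_ext (\<lambda>w. polylog w t) (nshuffle p q)
    = lin_ext (\<lambda>w. polylog w t) p * lin_ext (\<lambda>w. polylog w t) q"
  unfolding nshuffle_def using assms(1,2) unfolding H1_eq
proof (rule lin_ext_bilinear_ext)
  fix u v assume uv: "u \<in> H1_words" "v \<in> H1_words"
  then have H1: "word u \<in> H1" "word v \<in> H1"
    by (auto simp: H1_eq)
  then have "nshuffle_word u v \<in> H1"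
    using nshuffle_in_H1[of "word u" "word v"] by (simp add: nshuffle_def bilinear_ext_word)
  then have "lin_ext (\<lambda>w. polylog w t) (nshuffle_word u v) = eval_fps (coef_fps (nshuffle_word u v)) t"
    using assms(3) by (simp add: eval_coef_fps)
  also have "\<dots> = eval_fps (coef_fps (word u)) t * eval_fps (coef_fps (word v)) t"
  proof -
    have "ereal (norm t) < 1" using assms(3) by simp
    then show ?thesis
      unfolding coef_fps_nshuffle_word[OF uv]
      by (intro eval_fps_mult less_le_trans[OF _ fps_conv_radius_coef_fps] H1)
  qed
  finally show "lin_ext (\<lambda>w. polylog w t) (nshuffle_word u v) = polylog u t * polylog v t"
    using H1 assms(3) by (simp add: eval_coef_fps)
qed

lemma polylog_Nil: "polylog [] t = 1"
proof -
  have "(\<lambda>m. coef [] m * t ^ m) = (\<lambda>m. if m = 0 then 1 else 0)" by auto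
  then show ?thesis
    unfolding polylog_def using sums_single[of 0 "\<lambda>_. 1 :: real"] by (simp add: sums_iff)
qed

lemma polylog_Y:
  assumes "0 < t" "t < 1"
  shows "polylog [Y] t = - ln (1 - t)"
proof -
  have "polylog [Y] t = suminf (\<lambda>m. coef [Y] (Suc m) * t ^ Suc m)"
    unfolding polylog_def using suminf_split_head[OF summable_coef_power[of "[Y]" t]] assms
    by (simp add: H1_words_def)
  \<comment> \<open>The shape of the series for ln x in powers of x - 1, at x = 1 - t.\<close>
  also have "\<dots> = suminf (\<lambda>m. - ((- 1) ^ m * (1 / real (m + 1)) * ((1 - t) - 1) ^ Suc m))"
    by (intro arg_cong[of _ _ suminf] ext) (simp add: power_minus[of t] mult_ac)
  also have "\<dots> = - suminf (\<lambda>m. (- 1) ^ m * (1 / real (m + 1)) * ((1 - t) - 1) ^ Suc m)"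
  proof (rule suminf_minus)
    have "summable (\<lambda>m. coef [Y] (Suc m) * t ^ Suc m)"
      using summable_coef_power[of "[Y]" t] assms
      by (subst summable_Suc_iff) (simp add: H1_words_def)
    from summable_minus[OF this]
    show "summable (\<lambda>m. (- 1) ^ m * (1 / real (m + 1)) * ((1 - t) - 1) ^ Suc m)"
      by (rule summable_cong[THEN iffD1, rotated]) (simp add: power_minus[of t] mult_ac)
  qed
  also have "\<dots> = - ln (1 - t)"
    using ln_series[of "1 - t"] assms by simp
  finally show ?thesis .
qed

text \<open>The number 1 - t^m is at most 1 and, by Bernoulli, at most m (1-t). According to whether
  m (1-t) is \<le> 1 or not, the second or the first of these bounds is at most (m (1-t))^(1/4),
  whose factor m^(1/4) is the weight of \<open>summable_root_coef\<close>.\<close>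

lemma polylog_error:
  assumes "w \<in> H0_words" "0 < t" "t < 1"
  shows "\<bar>polylog w t - suminf (coef w)\<bar> \<le> suminf (\<lambda>m. real m powr (1/4) * coef w m) * (1 - t) powr (1/4)"
proof -
  have w: "w \<in> H1_words" using assms(1) H0_words_subset by blast
  note sum = summable_coef[OF assms(1)] summable_coef_power[OF w, of t] summable_root_coef[OF assms(1)]
  have *: "\<bar>coef w m * (1 - t ^ m)\<bar> \<le> real m powr (1/4) * coef w m * (1 - t) powr (1/4)" for m
  proof -
    have le1: "t ^ m \<le> 1" using assms by (simp add: power_le_one)
    have "1 - t ^ m \<le> (real m * (1 - t)) powr (1/4)"
    proof (cases "real m * (1 - t) \<le> 1")
      case True
      have "1 - t ^ m \<le> real m * (1 - t)"
        using Bernoulli_inequality[of "t - 1" m] assms by (simp add: algebra_simps)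
      also have "\<dots> \<le> (real m * (1 - t)) powr (1/4)"
        using True assms powr_mono'[of "1/4" 1 "real m * (1 - t)"] by simp
      finally show ?thesis .
    next
      case False
      then have "1 \<le> (real m * (1 - t)) powr (1/4)" by (simp add: ge_one_powr_ge_zero)
      moreover have "t ^ m \<ge> 0" using assms by simp
      ultimately show ?thesis by linarith
    qed
    then have "coef w m * (1 - t ^ m) \<le> coef w m * (real m * (1 - t)) powr (1/4)"
      using coef_nonneg by (rule mult_left_mono)
    then show ?thesis
      using assms le1 coef_nonneg[of w m] by (simp add: powr_mult abs_mult mult_ac)
  qed
  have eq: "suminf (coef w) - polylog w t = suminf (\<lambda>m. coef w m * (1 - t ^ m))"
    unfolding polylog_def using sum assms by (subst suminf_diff) (simp_all add: algebra_simps)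
  have "\<bar>suminf (coef w) - polylog w t\<bar> \<le> suminf (\<lambda>m. \<bar>coef w m * (1 - t ^ m)\<bar>)"
    unfolding eq
    by (rule summable_rabs, rule summable_comparison_test'[OF summable_mult2[OF sum(3)], where N = 0])
      (use * in auto)
  also have "\<dots> \<le> suminf (\<lambda>m. real m powr (1/4) * coef w m * (1 - t) powr (1/4))"
    using * by (intro suminf_le summable_mult2 sum(3)
        summable_comparison_test'[OF summable_mult2[OF sum(3)], where N = 0]) auto
  also have "\<dots> = suminf (\<lambda>m. real m powr (1/4) * coef w m) * (1 - t) powr (1/4)"
    using sum(3) by (rule suminf_mult2[symmetric])
  finally show ?thesis by (simp add: abs_minus_commute)
qed

lemma eventually_at_left_1: "\<forall>\<^sub>F t in at_left (1::real). 0 < t \<and> t < 1"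
  by (rule eventually_at_leftI[of 0]) auto

interpretation nshuffle: asymptotic_evaluation nshuffle "at_left 1" "\<lambda>t. - ln (1 - t)" polylog
proof
  show L: "filterlim (\<lambda>t. - ln (1 - t)) at_top (at_left (1::real))"
    by real_asymp
  fix w assume w: "w \<in> H0_words"
  show "negligible (at_left 1) (\<lambda>t. - ln (1 - t)) (\<lambda>t. polylog w t - zeta_bar (index_of w))"
  proof (rule negligible_exp_bound[OF L])
    show "\<forall>\<^sub>F t in at_left 1. \<bar>polylog w t - zeta_bar (index_of w)\<bar>
        \<le> suminf (\<lambda>m. real m powr (1/4) * coef w m) * exp (- (1/4) * - ln (1 - t))"
      using eventually_at_left_1
      by eventually_elim (use polylog_error[OF w] in \<open>simp add: zeta_bar_eq[OF w] powr_def\<close>)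
  qed simp
next
  fix p q assume "p \<in> H1" "q \<in> H1"
  then show "\<forall>\<^sub>F t in at_left 1. lin_ext (\<lambda>w. polylog w t) (nshuffle p q)
      = lin_ext (\<lambda>w. polylog w t) p * lin_ext (\<lambda>w. polylog w t) q"
    using eventually_at_left_1 by (auto elim!: eventually_mono intro!: polylog_nshuffle)
next
  show "\<forall>\<^sub>F t in at_left 1. polylog [Y] t = - ln (1 - t)"
    using eventually_at_left_1 by eventually_elim (simp add: polylog_Y)
qed (simp_all add: nshuffle_in_H1 triangular_nshuffle polylog_Nil)

section \<open>Abel summation at t = 1\<close>

lemma power_series_partial_sums:
  fixes b :: "nat \<Rightarrow> real"
  assumes "\<And>t. \<bar>t\<bar> < 1 \<Longrightarrow> summable (\<lambda>m. b m * t ^ m)" "\<bar>t\<bar> < 1"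
  shows "(\<lambda>m. (1 - t) * ((\<Sum>i\<le>m. b i) * t ^ m)) sums suminf (\<lambda>m. b m * t ^ m)"
proof -
  obtain r where r: "\<bar>t\<bar> < r" "r < 1" using assms(2) dense by blast
  then have "summable (\<lambda>m. b m * r ^ m)" using assms(1)[of r] by simp
  then have "summable (\<lambda>m. norm (b m * t ^ m))"
    by (rule powser_insidea) (use r in simp)
  moreover have "summable (\<lambda>m. norm (t ^ m))"
    using assms(2) by (simp add: power_abs summable_geometric)
  \<comment> \<open>Multiplication by the geometric series turns coefficients into partial sums; the
    factor 1 - t later undoes it.\<close>
  ultimately have "(\<lambda>m. \<Sum>i\<le>m. (b i * t ^ i) * t ^ (m - i)) sums (suminf (\<lambda>m. b m * t ^ m) * suminf (\<lambda>m. t ^ m))"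
    by (rule Cauchy_product_sums)
  moreover have "(\<Sum>i\<le>m. (b i * t ^ i) * t ^ (m - i)) = (\<Sum>i\<le>m. b i) * t ^ m" for m
    unfolding sum_distrib_right by (intro sum.cong) (auto simp: mult.assoc power_add[symmetric])
  ultimately have "(\<lambda>m. (\<Sum>i\<le>m. b i) * t ^ m) sums (suminf (\<lambda>m. b m * t ^ m) * (1 / (1 - t)))"
    using assms(2) by (simp add: suminf_geometric)
  from sums_mult[OF this, of "1 - t"] show ?thesis
    using assms(2) by simp
qed

text \<open>The power series is the mean of the partial sums with weights (1-t) t^m of total mass 1,
  and the mass of any initial segment tends to 0. Being one-sided, the bound also covers divergent
  partial sums.\<close>

lemma Abel_lower_bound:
  fixes b :: "nat \<Rightarrow> real"
  assumes b: "\<And>t. \<bar>t\<bar> < 1 \<Longrightarrow> summable (\<lambda>m. b m * t ^ m)"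
    and B: "\<forall>\<^sub>F N in sequentially. c \<le> (\<Sum>m\<le>N. b m)" and "e > 0"
  shows "\<forall>\<^sub>F t in at_left 1. c - e \<le> suminf (\<lambda>m. b m * t ^ m)"
proof -
  let ?B = "\<lambda>m. \<Sum>i\<le>m. b i"
  obtain N where N: "\<And>m. m \<ge> N \<Longrightarrow> c \<le> ?B m"
    using B by (auto simp: eventually_sequentially)
  \<comment> \<open>The finitely many partial sums that may lie below \<open>c\<close> contribute at
    least \<open>- (1 - t) * K\<close>.\<close>
  define K where "K = (\<Sum>m<N. \<bar>?B m - c\<bar>)"
  have "((\<lambda>t. (1 - t) * K) \<longlongrightarrow> (1 - 1) * K) (at_left 1)"
    by (intro tendsto_intros)
  then have "((\<lambda>t. (1 - t) * K) \<longlongrightarrow> 0) (at_left 1)" by simp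
  then have "\<forall>\<^sub>F t in at_left 1. (1 - t) * K < e"
    by (rule order_tendstoD(2)) fact
  with eventually_at_left_1 show ?thesis
  proof eventually_elim
    case (elim t)
    then have t: "\<bar>t\<bar> < 1" "0 < t" "t < 1" by auto
    have "(\<lambda>m. (1 - t) * (c * t ^ m)) sums ((1 - t) * (c * (1 / (1 - t))))"
      using t by (intro sums_mult geometric_sums) simp
    then have "(\<lambda>m. (1 - t) * (c * t ^ m)) sums c" using t by simp
    from sums_diff[OF power_series_partial_sums[OF b t(1)] this]
    have s: "(\<lambda>m. (1 - t) * ((?B m - c) * t ^ m)) sums (suminf (\<lambda>m. b m * t ^ m) - c)"
      by (simp add: algebra_simps)
    have "- ((1 - t) * K) \<le> (\<Sum>m<N. (1 - t) * ((?B m - c) * t ^ m))"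
    proof -
      have "\<bar>(?B m - c) * t ^ m\<bar> \<le> \<bar>?B m - c\<bar>" for m
        using t by (simp add: abs_mult power_le_one mult_left_le)
      then have "- \<bar>?B m - c\<bar> \<le> (?B m - c) * t ^ m" for m
        by (smt (verit))
      then have "- K \<le> (\<Sum>m<N. (?B m - c) * t ^ m)"
        unfolding K_def sum_negf[symmetric] by (rule sum_mono)
      then have "(1 - t) * - K \<le> (1 - t) * (\<Sum>m<N. (?B m - c) * t ^ m)"
        using t by (intro mult_left_mono) auto
      then show ?thesis by (simp add: sum_distrib_left)
    qed
    also have "\<dots> \<le> suminf (\<lambda>m. (1 - t) * ((?B m - c) * t ^ m))"
      using s N t by (intro sum_le_suminf) (auto simp: sums_iff not_less)
    also have "\<dots> = suminf (\<lambda>m. b m * t ^ m) - c"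
      using s by (simp add: sums_iff)
    finally show ?case using elim by simp
  qed
qed

text \<open>The one-sided bound is applied to \<open>b\<close> and to \<open>- b\<close>, losing e/3
  in the partial sums and e/3 in the passage to the power series, less than e in total.\<close>

lemma Abel_tendsto_0:
  fixes b :: "nat \<Rightarrow> real"
  assumes b: "\<And>t. \<bar>t\<bar> < 1 \<Longrightarrow> summable (\<lambda>m. b m * t ^ m)"
    and B: "(\<lambda>N. \<Sum>m\<le>N. b m) \<longlonglongrightarrow> 0"
  shows "((\<lambda>t. suminf (\<lambda>m. b m * t ^ m)) \<longlongrightarrow> 0) (at_left 1)"
proof (rule tendstoI)
  fix e :: real assume "e > 0"
  then have ev: "\<forall>\<^sub>F N in sequentially. \<bar>\<Sum>m\<le>N. b m\<bar> < e / 3"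
    using B by (auto simp: tendsto_iff dist_real_def dest: spec[of _ "e / 3"])
  have "\<forall>\<^sub>F t in at_left 1. - (e / 3) - e / 3 \<le> suminf (\<lambda>m. b m * t ^ m)"
    by (rule Abel_lower_bound[OF b]) (use ev \<open>e > 0\<close> in \<open>auto elim!: eventually_mono\<close>)
  moreover have "\<forall>\<^sub>F t in at_left 1. - (e / 3) - e / 3 \<le> suminf (\<lambda>m. - b m * t ^ m)"
    by (rule Abel_lower_bound)
      (use ev \<open>e > 0\<close> b in \<open>auto elim!: eventually_mono simp: sum_negf summable_minus\<close>)
  ultimately show "\<forall>\<^sub>F t in at_left 1. dist (suminf (\<lambda>m. b m * t ^ m)) 0 < e"
    using eventually_at_left_1
  proof eventually_elim
    case (elim t)
    then have "suminf (\<lambda>m. - b m * t ^ m) = - suminf (\<lambda>m. b m * t ^ m)"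
      using b[of t] by (simp add: suminf_minus)
    with elim \<open>e > 0\<close> show ?case by (auto simp: dist_real_def)
  qed
qed

section \<open>Comparison of the two regularizations\<close>

lemma lin_ext_psum: "lin_ext (\<lambda>w. psum w N) p = (\<Sum>m\<le>N. lin_ext (\<lambda>w. coef w m) p)"
  by (simp add: psum_def lin_ext_def sum_distrib_left sum.swap[of _ "{..N}"])

theorem theorem2p12:
  fixes w1 w2 :: ncpoly
  assumes "w1 \<in> H1" and "w2 \<in> H0"
  shows "Zbar_harm (nshuffle w1 w2 - nharm w1 w2) = 0 \<and>
         Zbar_shuffle (nshuffle w1 w2 - nharm w1 w2) = 0"
proof
  let ?p = "nshuffle w1 w2 - nharm w1 w2"
  have w2: "w2 \<in> H1" using assms(2) H0_subset_H1 by blast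
  have H1: "nharm w1 w2 \<in> H1" "nshuffle w1 w2 \<in> H1"
    using assms w2 nharm_in_H1 nshuffle_in_H1 by auto
  then have p: "?p \<in> H1" unfolding H1_eq by blast

  define b where "b m = lin_ext (\<lambda>w. coef w m) (nharm w1 w2) - Zbar w2 * lin_ext (\<lambda>w. coef w m) w1" for m
  have b: "(\<lambda>m. b m * t ^ m) sums
      (lin_ext (\<lambda>w. polylog w t) (nharm w1 w2) - Zbar w2 * lin_ext (\<lambda>w. polylog w t) w1)"
    if "\<bar>t\<bar> < 1" for t
    using sums_diff[OF sums_lin_ext_coef[OF H1(1) that]
        sums_mult[OF sums_lin_ext_coef[OF assms(1) that], of "Zbar w2"]]
    by (simp add: b_def algebra_simps)
  have "(\<lambda>N. \<Sum>m\<le>N. b m) \<longlonglongrightarrow> 0"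
    using nharm.tendsto_ev_prd_H0[OF assms]
    by (simp add: b_def lin_ext_psum sum_subtractf sum_distrib_left)
  then have "((\<lambda>t. suminf (\<lambda>m. b m * t ^ m)) \<longlongrightarrow> 0) (at_left 1)"
    using b by (intro Abel_tendsto_0) (auto simp: sums_iff)
  then have "((\<lambda>t. lin_ext (\<lambda>w. polylog w t) (nharm w1 w2)
      - Zbar w2 * lin_ext (\<lambda>w. polylog w t) w1) \<longlongrightarrow> 0) (at_left 1)"
    by (rule Lim_transform_eventually)
      (use b eventually_at_left_1 in \<open>auto elim!: eventually_mono simp: sums_iff\<close>)
  \<comment> \<open>The multiples of the polylogarithm of \<open>w1\<close> by
    \<open>Zbar w2\<close> cancel in this difference.\<close>
  from tendsto_diff[OF nshuffle.tendsto_ev_prd_H0[OF assms] this]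
  have lim: "((\<lambda>t. lin_ext (\<lambda>w. polylog w t) ?p) \<longlongrightarrow> 0) (at_left 1)"
    by (simp add: lin_ext_diff)
  then show "Zbar_shuffle ?p = 0"
    unfolding Zbar_shuffle_def by (rule nshuffle.Zbar_ext_eq_0[OF p])

  show "Zbar_harm ?p = 0"
  proof (rule ccontr)
    assume "Zbar_harm ?p \<noteq> 0"
    then obtain s c :: real where c: "c > 0"
      "\<forall>\<^sub>F N in sequentially. s * lin_ext (\<lambda>w. psum w N) ?p \<ge> c"
      using nharm.Zbar_ext_nonzero_bound[OF p] unfolding Zbar_harm_def by blast
    have s: "(\<lambda>m. s * lin_ext (\<lambda>w. coef w m) ?p * t ^ m) sums (s * lin_ext (\<lambda>w. polylog w t) ?p)"
      if "\<bar>t\<bar> < 1" for t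
      using sums_mult[OF sums_lin_ext_coef[OF p that], of s] by (simp add: mult.assoc)
    \<comment> \<open>The truncated sums of \<open>?p\<close> might diverge here, so the one-sided
      bound replaces the statement on limits; after multiplication by \<open>s\<close> it
      contradicts \<open>lim\<close>.\<close>
    have "\<forall>\<^sub>F t in at_left 1. c - c / 2 \<le> suminf (\<lambda>m. s * lin_ext (\<lambda>w. coef w m) ?p * t ^ m)"
      using c s by (intro Abel_lower_bound) (auto simp: sums_iff lin_ext_psum sum_distrib_left)
    with eventually_at_left_1
    have "\<forall>\<^sub>F t in at_left 1. c / 2 \<le> s * lin_ext (\<lambda>w. polylog w t) ?p"
      by eventually_elim (use s in \<open>auto simp: sums_iff\<close>)
    with tendsto_mult_right_zero[OF lim, of s] have "c / 2 \<le> 0"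
      by (rule tendsto_lowerbound) simp
    with c show False by simp
  qed
qed

end
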